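(* Let $\mathbb{F}$ be a finite field of order $q$, let $\mathcal{L}$ be the set of all $1$-dimensional $\mathbb{F}$-subspaces (lines) of the vector space $V=\mathbb{F}^2$, let $\Pi$ be a partition of $\mathcal{L}$, and let $\mathcal{S}(\Pi)$ be the associated Schur ring over the elementary abelian group $H\cong V^+$ of order $q^2$. Put $\mathcal{M}(\Pi)=\{\alpha\in\mathbb{F}\cup\{\infty\}\mid \{L_\alpha\}\in\Pi\}$. Suppose that $\{\infty,0,1\}\subset\mathcal{M}(\Pi)$ and that $\mathcal{M}(\Pi)\setminus\{\infty\}$ is not a subfield of $\mathbb{F}$. Then the Schur ring $\mathcal{S}(\Pi)$ is non-schurian (i.e. not schurian).
   Context: Lines: $\mathcal{L}=\{L_\alpha\mid\alpha\in\mathbb{F}\cup\{\infty\}\}$, where $L_\alpha=\{(x,\alpha x)\mid x\in\mathbb{F}\}$ for $\alpha\in\mathbb{F}$ and $L_\infty=\{(0,x)\mid x\in\mathbb{F}\}$. Put $L_\alpha^\sharp=L_\alpha\setminus\{(0,0)\}$. Schur rings: Let $H$ be a finite group, $\mathbb{Z}H$ its integral group ring, and for $X\subset H$ put $\underline{X}=\sum_{x\in X}x\in\mathbb{Z}H$. Given a partition $\mathcal{P}$ of $H$ into nonempty subsets, the $\mathbb{Z}$-submodule $\mathcal{A}=\bigoplus_{X\in\mathcal{P}}\mathbb{Z}\,\underline{X}$ of $\mathbb{Z}H$ is a Schur ring over $H$ if (S1) $\{1_H\}\in\mathcal{P}$; (S2) $\{x^{-1}\mid x\in X\}\in\mathcal{P}$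 for all $X\in\mathcal{P}$; (S3) $\mathcal{A}$ is a subring of $\mathbb{Z}H$. Schurian: A Schur ring over $H$ with partition $\mathcal{P}$ is schurian if there is a permutation group $G\le\mathrm{Sym}(H)$ containing $H$ as a regular subgroup ($H$ acting on itself by translations) such that $\mathcal{P}$ is the set of orbits on $H$ of the stabilizer $G_1$ of the point $1_H$ in $G$. The Schur ring $\mathcal{S}(\Pi)$: Let $H$ be an elementary abelian group of order $q^2$, written multiplicatively, with a fixed isomorphism $\rho:V^+\to H$, where $V^+$ is the additive group of $V$. For a partition $\Pi=\{P_1,\dots,P_r\}$ of $\mathcal{L}$ into $r\ge1$ nonempty disjoint subsets, put $\widetilde{P}_i=\bigcup_{L_\alpha\in P_i}L_\alpha^\sharp$ and $\underline{\widetilde{P}_i}=\sum_{L_\alpha\in P_i}\sum_{\boldsymbol{x}\in L_\alpha^\sharp}\rho(\boldsymbol{x})\in\mathbb{Z}H$. Then $\mathcal{S}(\Pi)=\mathbb{Z}\rho(0,0)\oplus\bigoplus_{i=1}^r\mathbb{Z}\,\underline{\widetilde{P}_i}\subset\mathbb{Z}H$, which is a Schur ring over $H$ with respect to the partition $\{\{1_H\},\rho(\widetilde{P}_1),\dots,\rho(\widetilde{P}_r)\}$ of $H$. *)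

theory Defs
  imports "HOL-Algebra.Subrings" "HOL-Algebra.Group_Action" "HOL-Library.Disjoint_Sets" "HOL-Library.Indicator_Function"
begin

section \<open>Schur rings over a finite group\<close>

text \<open>
  The integral group ring of a finite group: an element is its coefficient function, which is
  set to zero outside the carrier. The product is convolution.
\<close>

definition int_group_ring :: "('h, 'm) monoid_scheme \<Rightarrow> ('h \<Rightarrow> int) ring" where
  "int_group_ring H =
    \<lparr>carrier = {f. \<forall>x. x \<notin> carrier H \<longrightarrow> f x = 0},
     mult = (\<lambda>f g x. \<Sum>(y, z) | y \<in> carrier H \<and> z \<in> carrier H \<and> y \<otimes>\<^bsub>H\<^esub> z = x. f y * g z),
     one = indicator {\<one>\<^bsub>H\<^esub>},
     zero = (\<lambda>x. 0),
     add = (\<lambda>f g x. f x + g x)\<rparr>"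

definition simple_quantity :: "'h set \<Rightarrow> 'h \<Rightarrow> int" where
  "simple_quantity X = indicator X"

text \<open>
  For disjoint nonempty sets the simple quantities are linearly independent, so their span is the
  direct sum.
\<close>

definition int_span :: "'h set set \<Rightarrow> ('h \<Rightarrow> int) set" where
  "int_span \<P> = {(\<lambda>x. \<Sum>X\<in>\<P>. c X * simple_quantity X x) | c. True}"

definition schur_ring :: "('h, 'm) monoid_scheme \<Rightarrow> 'h set set \<Rightarrow> ('h \<Rightarrow> int) set \<Rightarrow> bool" where
  "schur_ring H \<P> \<A> \<longleftrightarrow>
     group H \<and> finite (carrier H) \<and> partition_on (carrier H) \<P> \<and> \<A> = int_span \<P> \<and>
     {\<one>\<^bsub>H\<^esub>} \<in> \<P> \<and>
     (\<forall>X\<in>\<P>. m_inv H ` X \<in> \<P>) \<and>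
     subring \<A> (int_group_ring H)"

definition translation_perms :: "('h, 'm) monoid_scheme \<Rightarrow> ('h \<Rightarrow> 'h) set" where
  "translation_perms H = {(\<lambda>x\<in>carrier H. x \<otimes>\<^bsub>H\<^esub> h) | h. h \<in> carrier H}"

definition point_stabilizer :: "('h, 'm) monoid_scheme \<Rightarrow> ('h \<Rightarrow> 'h) set \<Rightarrow> ('h \<Rightarrow> 'h) set" where
  "point_stabilizer H G =
     stabilizer (BijGroup (carrier H)\<lparr>carrier := G\<rparr>) (\<lambda>g. g) \<one>\<^bsub>H\<^esub>"

text \<open>
  The partition \<open>\<P>\<close> in the next definition is determined by \<open>\<A>\<close>, see \<open>int_span_inject\<close> below.
\<close>

definition schurian :: "('h, 'm) monoid_scheme \<Rightarrow> ('h \<Rightarrow> int) set \<Rightarrow> bool" where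
  "schurian H \<A> \<longleftrightarrow>
     (\<exists>\<P>. schur_ring H \<P> \<A> \<and>
        (\<exists>G. subgroup G (BijGroup (carrier H)) \<and> translation_perms H \<subseteq> G \<and>
             \<P> = orbits (BijGroup (carrier H)\<lparr>carrier := point_stabilizer H G\<rparr>)
                   (carrier H) (\<lambda>g. g)))"


section \<open>Lines of the plane over a field\<close>

definition plane_group :: "('a, 'm) ring_scheme \<Rightarrow> ('a \<times> 'a) monoid" where
  "plane_group F = add_monoid F \<times>\<times> add_monoid F"

text \<open>Slopes are elements of \<open>F \<union> {\<infinity>}\<close>; \<^term>\<open>None\<close> stands for \<open>\<infinity>\<close>.\<close>

definition slopes :: "('a, 'm) ring_scheme \<Rightarrow> 'a option set" where
  "slopes F = insert None (Some ` carrier F)"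

definition line :: "('a, 'm) ring_scheme \<Rightarrow> 'a option \<Rightarrow> ('a \<times> 'a) set" where
  "line F s = (case s of
      Some \<alpha> \<Rightarrow> {(x, \<alpha> \<otimes>\<^bsub>F\<^esub> x) | x. x \<in> carrier F}
    | None \<Rightarrow> {(\<zero>\<^bsub>F\<^esub>, x) | x. x \<in> carrier F})"

definition lines :: "('a, 'm) ring_scheme \<Rightarrow> ('a \<times> 'a) set set" where
  "lines F = line F ` slopes F"

definition singleton_slopes ::
    "('a, 'm) ring_scheme \<Rightarrow> ('a \<times> 'a) set set set \<Rightarrow> 'a option set" where
  "singleton_slopes F \<pi> = {s \<in> slopes F. {line F s} \<in> \<pi>}"

definition punctured_union ::
    "('a, 'm) ring_scheme \<Rightarrow> ('a \<times> 'a) set set \<Rightarrow> ('a \<times> 'a) set" where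
  "punctured_union F P = (\<Union>L\<in>P. L - {(\<zero>\<^bsub>F\<^esub>, \<zero>\<^bsub>F\<^esub>)})"

definition line_basic_sets ::
    "('a, 'm) ring_scheme \<Rightarrow> ('a \<times> 'a \<Rightarrow> 'h) \<Rightarrow> ('a \<times> 'a) set set set \<Rightarrow> 'h set set" where
  "line_basic_sets F \<rho> \<pi> =
     insert {\<rho> (\<zero>\<^bsub>F\<^esub>, \<zero>\<^bsub>F\<^esub>)} ((\<lambda>P. \<rho> ` punctured_union F P) ` \<pi>)"

definition line_schur_ring ::
    "('a, 'm) ring_scheme \<Rightarrow> ('a \<times> 'a \<Rightarrow> 'h) \<Rightarrow> ('a \<times> 'a) set set set \<Rightarrow> ('h \<Rightarrow> int) set" where
  "line_schur_ring F \<rho> \<pi> = int_span (line_basic_sets F \<rho> \<pi>)"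


section \<open>The integral group ring is a ring\<close>

lemma carrier_gr: "carrier (int_group_ring H) = {f. \<forall>x. x \<notin> carrier H \<longrightarrow> f x = 0}"
  by (simp add: int_group_ring_def)

lemma add_gr: "f \<oplus>\<^bsub>int_group_ring H\<^esub> g = (\<lambda>x. f x + g x)"
  by (simp add: int_group_ring_def)

lemma zero_gr: "\<zero>\<^bsub>int_group_ring H\<^esub> = (\<lambda>x. 0)"
  by (simp add: int_group_ring_def)

lemma one_gr: "\<one>\<^bsub>int_group_ring H\<^esub> = indicator {\<one>\<^bsub>H\<^esub>}"
  by (simp add: int_group_ring_def)

lemma mult_gr:
  "f \<otimes>\<^bsub>int_group_ring H\<^esub> g =
    (\<lambda>x. \<Sum>(y, z) | y \<in> carrier H \<and> z \<in> carrier H \<and> y \<otimes>\<^bsub>H\<^esub> z = x. f y * g z)"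
  by (simp add: int_group_ring_def)

lemma mult_gr_double:
  assumes "finite (carrier H)"
  shows "(f \<otimes>\<^bsub>int_group_ring H\<^esub> g) x =
    (\<Sum>y\<in>carrier H. \<Sum>z\<in>carrier H. if y \<otimes>\<^bsub>H\<^esub> z = x then f y * g z else 0)"
proof -
  have "(f \<otimes>\<^bsub>int_group_ring H\<^esub> g) x =
      (\<Sum>p\<in>{p \<in> carrier H \<times> carrier H. fst p \<otimes>\<^bsub>H\<^esub> snd p = x}. f (fst p) * g (snd p))"
    unfolding mult_gr by (rule sum.cong) auto
  also have "\<dots> = (\<Sum>p\<in>carrier H \<times> carrier H.
      if fst p \<otimes>\<^bsub>H\<^esub> snd p = x then f (fst p) * g (snd p) else 0)"
    using assms by (subst sum.inter_filter) auto
  also have "\<dots> = (\<Sum>y\<in>carrier H. \<Sum>z\<in>carrier H. if y \<otimes>\<^bsub>H\<^esub> z = x then f y * g z else 0)"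
    unfolding sum.cartesian_product by (rule sum.cong) auto
  finally show ?thesis .
qed

lemma mult_gr_closed:
  assumes "group H"
  shows "f \<otimes>\<^bsub>int_group_ring H\<^esub> g \<in> carrier (int_group_ring H)"
proof -
  interpret group H by fact
  show ?thesis
    unfolding carrier_gr mult_gr
  proof (intro CollectI allI impI)
    fix x assume "x \<notin> carrier H"
    hence e: "{(y, z). y \<in> carrier H \<and> z \<in> carrier H \<and> y \<otimes>\<^bsub>H\<^esub> z = x} = {}" by auto
    thus "(\<Sum>(y, z) | y \<in> carrier H \<and> z \<in> carrier H \<and> y \<otimes>\<^bsub>H\<^esub> z = x. f y * g z) = 0"
      unfolding e by simp
  qed
qed

lemma ring_int_group_ring:
  fixes H (structure)
  assumes "group H" "finite (carrier H)"
  shows "ring (int_group_ring H)"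
proof (rule ringI)
  interpret group H by fact
  let ?R = "int_group_ring H" and ?C = "carrier H"
  note fin = assms(2)
  note d = mult_gr_double[OF fin]
  have if_mult: "(if P then s else 0) * t = (if P then s * t else 0)"
    and mult_if: "t * (if P then s else 0) = (if P then t * s else 0)" for P and s t :: int
    by auto
  show "abelian_group ?R"
  proof (rule abelian_groupI)
    fix f assume "f \<in> carrier ?R"
    thus "\<exists>g\<in>carrier ?R. g \<oplus>\<^bsub>?R\<^esub> f = \<zero>\<^bsub>?R\<^esub>"
      by (intro bexI[of _ "\<lambda>x. - f x"]) (auto simp: carrier_gr add_gr zero_gr)
  qed (auto simp: carrier_gr add_gr zero_gr)
  have assoc: "((f \<otimes>\<^bsub>?R\<^esub> g) \<otimes>\<^bsub>?R\<^esub> h) x = (f \<otimes>\<^bsub>?R\<^esub> (g \<otimes>\<^bsub>?R\<^esub> h)) x" for f g h x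
  proof -
    have "((f \<otimes>\<^bsub>?R\<^esub> g) \<otimes>\<^bsub>?R\<^esub> h) x =
       (\<Sum>u\<in>?C. \<Sum>w\<in>?C. \<Sum>y\<in>?C. \<Sum>z\<in>?C.
          if y \<otimes> z = u then if u \<otimes> w = x then f y * g z * h w else 0 else 0)"
      unfolding d[of "f \<otimes>\<^bsub>?R\<^esub> g" h] d[of f g] sum_distrib_right if_mult
      by (intro sum.cong refl) (auto cong: if_cong)
    also have "\<dots> = (\<Sum>w\<in>?C. \<Sum>y\<in>?C. \<Sum>z\<in>?C. \<Sum>u\<in>?C.
          if y \<otimes> z = u then if u \<otimes> w = x then f y * g z * h w else 0 else 0)"
      by (rule trans[OF sum.swap], rule sum.cong[OF refl], rule trans[OF sum.swap],
          rule sum.cong[OF refl], rule sum.swap)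
    also have "\<dots> = (\<Sum>w\<in>?C. \<Sum>y\<in>?C. \<Sum>z\<in>?C.
          if (y \<otimes> z) \<otimes> w = x then f y * g z * h w else 0)"
      by (intro sum.cong refl) (simp add: fin)
    also have "\<dots> = (\<Sum>y\<in>?C. \<Sum>z\<in>?C. \<Sum>w\<in>?C.
          if (y \<otimes> z) \<otimes> w = x then f y * g z * h w else 0)"
      by (rule trans[OF sum.swap], rule sum.cong[OF refl], rule sum.swap)
    also have "\<dots> = (\<Sum>y\<in>?C. \<Sum>z\<in>?C. \<Sum>w\<in>?C.
          if y \<otimes> (z \<otimes> w) = x then f y * g z * h w else 0)"
      by (intro sum.cong refl) (simp add: m_assoc)
    also have "\<dots> = (\<Sum>y\<in>?C. \<Sum>z\<in>?C. \<Sum>w\<in>?C. \<Sum>u\<in>?C.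
          if z \<otimes> w = u then if y \<otimes> u = x then f y * g z * h w else 0 else 0)"
      by (intro sum.cong refl) (simp add: fin)
    also have "\<dots> = (\<Sum>y\<in>?C. \<Sum>u\<in>?C. \<Sum>z\<in>?C. \<Sum>w\<in>?C.
          if z \<otimes> w = u then if y \<otimes> u = x then f y * g z * h w else 0 else 0)"
    proof (rule sum.cong[OF refl])
      fix y
      let ?t = "\<lambda>z w u. if z \<otimes> w = u then if y \<otimes> u = x then f y * g z * h w else 0 else 0"
      have "(\<Sum>z\<in>?C. \<Sum>w\<in>?C. \<Sum>u\<in>?C. ?t z w u) = (\<Sum>z\<in>?C. \<Sum>u\<in>?C. \<Sum>w\<in>?C. ?t z w u)"
        by (rule sum.cong[OF refl], rule sum.swap)
      also have "\<dots> = (\<Sum>u\<in>?C. \<Sum>z\<in>?C. \<Sum>w\<in>?C. ?t z w u)" by (rule sum.swap)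
      finally show "(\<Sum>z\<in>?C. \<Sum>w\<in>?C. \<Sum>u\<in>?C. ?t z w u) = \<dots>" .
    qed
    also have "\<dots> = (f \<otimes>\<^bsub>?R\<^esub> (g \<otimes>\<^bsub>?R\<^esub> h)) x"
      unfolding d[of f "g \<otimes>\<^bsub>?R\<^esub> h"] d[of g h] sum_distrib_left mult_if
      by (intro sum.cong refl) (auto simp: mult.assoc cong: if_cong)
    finally show ?thesis .
  qed
  show "monoid ?R"
  proof (rule monoidI)
    show "\<one>\<^bsub>?R\<^esub> \<in> carrier ?R" by (auto simp: one_gr carrier_gr indicator_def)
    show "(f \<otimes>\<^bsub>?R\<^esub> g) \<otimes>\<^bsub>?R\<^esub> h = f \<otimes>\<^bsub>?R\<^esub> (g \<otimes>\<^bsub>?R\<^esub> h)" for f g h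
      using assoc by blast
    fix f assume f: "f \<in> carrier ?R"
    show "\<one>\<^bsub>?R\<^esub> \<otimes>\<^bsub>?R\<^esub> f = f"
    proof
      fix x
      have "(\<one>\<^bsub>?R\<^esub> \<otimes>\<^bsub>?R\<^esub> f) x = (\<Sum>y\<in>?C. if y = \<one> then (\<Sum>z\<in>?C. if z = x then f z else 0) else 0)"
        unfolding d one_gr by (intro sum.cong refl) (auto simp: indicator_def cong: if_cong)
      also have "\<dots> = f x" using f by (auto simp: fin carrier_gr)
      finally show "(\<one>\<^bsub>?R\<^esub> \<otimes>\<^bsub>?R\<^esub> f) x = f x" .
    qed
    show "f \<otimes>\<^bsub>?R\<^esub> \<one>\<^bsub>?R\<^esub> = f"
    proof
      fix x
      have "(f \<otimes>\<^bsub>?R\<^esub> \<one>\<^bsub>?R\<^esub>) x = (\<Sum>y\<in>?C. \<Sum>z\<in>?C. if z = \<one> then (if y = x then f y else 0) else 0)"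
        unfolding d one_gr by (intro sum.cong refl) (auto simp: indicator_def cong: if_cong)
      also have "\<dots> = f x" using f by (auto simp: fin carrier_gr)
      finally show "(f \<otimes>\<^bsub>?R\<^esub> \<one>\<^bsub>?R\<^esub>) x = f x" .
    qed
  qed (rule mult_gr_closed[OF assms(1)])
  show "(f \<oplus>\<^bsub>?R\<^esub> g) \<otimes>\<^bsub>?R\<^esub> h = f \<otimes>\<^bsub>?R\<^esub> h \<oplus>\<^bsub>?R\<^esub> g \<otimes>\<^bsub>?R\<^esub> h" for f g h
    unfolding add_gr mult_gr by (simp add: sum.distrib[symmetric] case_prod_beta algebra_simps)
  show "h \<otimes>\<^bsub>?R\<^esub> (f \<oplus>\<^bsub>?R\<^esub> g) = h \<otimes>\<^bsub>?R\<^esub> f \<oplus>\<^bsub>?R\<^esub> h \<otimes>\<^bsub>?R\<^esub> g" for f g h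
    unfolding add_gr mult_gr by (simp add: sum.distrib[symmetric] case_prod_beta algebra_simps)
qed


section \<open>A partition of the lines yields a Schur ring\<close>

lemma int_span_iff:
  assumes "partition_on C \<P>" "finite C"
  shows "f \<in> int_span \<P> \<longleftrightarrow>
    (\<forall>x. x \<notin> C \<longrightarrow> f x = 0) \<and> (\<forall>X\<in>\<P>. \<forall>x\<in>X. \<forall>y\<in>X. f x = f y)"
proof -
  have fin: "finite \<P>" using assms finite_elements by blast
  have disj: "X = Y" if "X \<in> \<P>" "Y \<in> \<P>" "x \<in> X" "x \<in> Y" for X Y x
    using assms(1) that unfolding partition_on_def disjoint_def by blast
  have cov: "x \<in> C \<longleftrightarrow> (\<exists>X\<in>\<P>. x \<in> X)" for x
    using assms(1) unfolding partition_on_def by blast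
  have val: "(\<Sum>X\<in>\<P>. c X * simple_quantity X x) = c Y" if "Y \<in> \<P>" "x \<in> Y" for c x Y
  proof -
    have "(\<Sum>X\<in>\<P>. c X * simple_quantity X x) = (\<Sum>X\<in>\<P>. if X = Y then c X else 0)"
      using that disj by (intro sum.cong) (auto simp: simple_quantity_def indicator_def)
    thus ?thesis using fin that by simp
  qed
  have out: "(\<Sum>X\<in>\<P>. c X * simple_quantity X x) = 0" if "x \<notin> C" for c x
    using that cov by (intro sum.neutral) (auto simp: simple_quantity_def indicator_def)
  show ?thesis
  proof
    assume "f \<in> int_span \<P>"
    then obtain c where c: "f = (\<lambda>x. \<Sum>X\<in>\<P>. c X * simple_quantity X x)"
      unfolding int_span_def by blast
    show "(\<forall>x. x \<notin> C \<longrightarrow> f x = 0) \<and> (\<forall>X\<in>\<P>. \<forall>x\<in>X. \<forall>y\<in>X. f x = f y)"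
      unfolding c using val out by auto
  next
    assume r: "(\<forall>x. x \<notin> C \<longrightarrow> f x = 0) \<and> (\<forall>X\<in>\<P>. \<forall>x\<in>X. \<forall>y\<in>X. f x = f y)"
    have "f = (\<lambda>x. \<Sum>X\<in>\<P>. f (SOME y. y \<in> X) * simple_quantity X x)"
    proof
      fix x
      show "f x = (\<Sum>X\<in>\<P>. f (SOME y. y \<in> X) * simple_quantity X x)"
      proof (cases "x \<in> C")
        case True
        then obtain Y where Y: "Y \<in> \<P>" "x \<in> Y" using cov by blast
        hence "(SOME y. y \<in> Y) \<in> Y" by (metis someI)
        thus ?thesis using val[OF Y, of "\<lambda>X. f (SOME y. y \<in> X)"] r Y by metis
      next
        case False
        thus ?thesis using out r by simp
      qed
    qed
    thus "f \<in> int_span \<P>" unfolding int_span_def by (intro CollectI exI conjI) auto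
  qed
qed

lemma int_span_inject:
  assumes "partition_on C \<P>" "partition_on C \<Q>" "finite C" "int_span \<P> = int_span \<Q>"
  shows "\<P> = \<Q>"
proof -
  have *: "Y \<subseteq> X" if p: "partition_on C \<P>" "partition_on C \<Q>" "int_span \<P> = int_span \<Q>"
    and X: "X \<in> \<P>" "Y \<in> \<Q>" "x \<in> X" "x \<in> Y" for \<P> \<Q> X Y x
  proof -
    have "simple_quantity X \<in> int_span \<P>"
      unfolding int_span_iff[OF p(1) assms(3)]
    proof (intro conjI allI impI ballI)
      show "simple_quantity X y = 0" if "y \<notin> C" for y
        using that p(1) X(1) by (auto simp: partition_on_def simple_quantity_def indicator_def)
      show "simple_quantity X y = simple_quantity X z" if "Z \<in> \<P>" "y \<in> Z" "z \<in> Z" for Z y z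
      proof -
        have "Z = X \<or> Z \<inter> X = {}"
          using p(1) X(1) that(1) unfolding partition_on_def disjoint_def by blast
        thus ?thesis using that by (auto simp: simple_quantity_def indicator_def)
      qed
    qed
    hence "simple_quantity X \<in> int_span \<Q>" using p(3) by simp
    hence "simple_quantity X y = simple_quantity X x" if "y \<in> Y" for y
      using that X(2,4) unfolding int_span_iff[OF p(2) assms(3)] by blast
    hence "simple_quantity X y = 1" if "y \<in> Y" for y
      using that X(3) by (simp add: simple_quantity_def)
    thus "Y \<subseteq> X" by (force simp: simple_quantity_def indicator_def)
  qed
  have "\<P> \<subseteq> \<Q>" if p: "partition_on C \<P>" "partition_on C \<Q>" "int_span \<P> = int_span \<Q>" for \<P> \<Q>
  proof
    fix X assume X: "X \<in> \<P>"
    have "X \<noteq> {}" using X p(1) unfolding partition_on_def by metis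
    then obtain x where x: "x \<in> X" by blast
    hence "x \<in> C" using X p(1) unfolding partition_on_def by blast
    then obtain Y where Y: "Y \<in> \<Q>" "x \<in> Y" using p(2) unfolding partition_on_def by blast
    have "Y = X" using *[OF p X Y(1) x Y(2)] *[OF p(2,1) p(3)[symmetric] Y(1) X Y(2) x] by simp
    thus "X \<in> \<Q>" using Y by simp
  qed
  from this[OF assms(1,2,4)] this[OF assms(2,1) assms(4)[symmetric]] show ?thesis by simp
qed

lemma mult_gr_sum_left:
  "((\<lambda>x. \<Sum>i\<in>I. a i * f i x) \<otimes>\<^bsub>int_group_ring H\<^esub> g) x =
    (\<Sum>i\<in>I. a i * (f i \<otimes>\<^bsub>int_group_ring H\<^esub> g) x)"
  unfolding mult_gr
  by (simp add: sum_distrib_left sum_distrib_right case_prod_beta mult.assoc, rule sum.swap)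

lemma mult_gr_sum_right:
  "(g \<otimes>\<^bsub>int_group_ring H\<^esub> (\<lambda>x. \<Sum>i\<in>I. a i * f i x)) x =
    (\<Sum>i\<in>I. a i * (g \<otimes>\<^bsub>int_group_ring H\<^esub> f i) x)"
  unfolding mult_gr
  by (simp add: sum_distrib_left sum_distrib_right case_prod_beta mult.left_commute, rule sum.swap)

lemma mult_gr_scale_left:
  "(\<lambda>x. k * f x) \<otimes>\<^bsub>int_group_ring H\<^esub> g = (\<lambda>x. k * (f \<otimes>\<^bsub>int_group_ring H\<^esub> g) x)"
  unfolding mult_gr by (simp add: sum_distrib_left case_prod_beta mult.assoc)

lemma mult_gr_scale_right:
  "f \<otimes>\<^bsub>int_group_ring H\<^esub> (\<lambda>x. k * g x) = (\<lambda>x. k * (f \<otimes>\<^bsub>int_group_ring H\<^esub> g) x)"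
  unfolding mult_gr by (simp add: sum_distrib_left case_prod_beta mult.left_commute)

lemma mult_gr_indicator:
  assumes "finite (carrier H)" "K \<subseteq> carrier H" "M \<subseteq> carrier H"
  shows "(indicator K \<otimes>\<^bsub>int_group_ring H\<^esub> indicator M) x =
    int (card {p \<in> K \<times> M. fst p \<otimes>\<^bsub>H\<^esub> snd p = x})"
proof -
  let ?S = "{(y, z). y \<in> carrier H \<and> z \<in> carrier H \<and> y \<otimes>\<^bsub>H\<^esub> z = x}"
  have fin: "finite ?S"
    by (rule finite_subset[of _ "carrier H \<times> carrier H"]) (use assms in auto)
  have "(indicator K \<otimes>\<^bsub>int_group_ring H\<^esub> indicator M) x =
      (\<Sum>p\<in>?S. indicator (K \<times> M) p)"
    unfolding mult_gr by (rule sum.cong) (auto simp: indicator_def)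
  also have "\<dots> = int (card (?S \<inter> K \<times> M))"
    using sum_indicator_eq_card[OF fin, of "K \<times> M"] fin
    by (simp add: indicator_def of_bool_def sum.If_cases Int_def)
  also have "?S \<inter> K \<times> M = {p \<in> K \<times> M. fst p \<otimes>\<^bsub>H\<^esub> snd p = x}"
    using assms by auto
  finally show ?thesis .
qed

lemma schur_ring_spread:
  fixes H (structure)
  assumes H: "group H" "finite (carrier H)" "card (carrier H) = q * q" and q: "q \<ge> 2"
    and sub: "\<And>K. K \<in> \<K> \<Longrightarrow> subgroup K H" and cardK: "\<And>K. K \<in> \<K> \<Longrightarrow> card K = q"
    and triv: "\<And>K M. K \<in> \<K> \<Longrightarrow> M \<in> \<K> \<Longrightarrow> K \<noteq> M \<Longrightarrow> K \<inter> M = {\<one>}"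
    and cover: "\<Union>\<K> = carrier H" and part: "partition_on \<K> \<Psi>"
  defines "\<P> \<equiv> insert {\<one>} ((\<lambda>P. \<Union>K\<in>P. K - {\<one>}) ` \<Psi>)"
  shows "schur_ring H \<P> (int_span \<P>)"
proof -
  interpret group H by fact
  let ?C = "carrier H" and ?R = "int_group_ring H"
  interpret R: ring ?R by (rule ring_int_group_ring[OF H(1,2)])
  have KC: "K \<subseteq> ?C" if "K \<in> \<K>" for K using cover that by blast
  have oneK: "\<one> \<in> K" if "K \<in> \<K>" for K using sub[OF that] by (rule subgroup.one_closed)
  have finK: "finite K" if "K \<in> \<K>" for K using KC[OF that] H(2) finite_subset by blast
  have fin: "finite \<K>" using KC H(2) by (meson finite_Pow_iff finite_subset PowI subsetI)
  have unq: "K = M" if "K \<in> \<K>" "M \<in> \<K>" "x \<in> K" "x \<in> M" "x \<noteq> \<one>" for K M x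
    using triv[of K M] that by blast
  have nonid: "\<exists>x\<in>K. x \<noteq> \<one>" if "K \<in> \<K>" for K
  proof (rule ccontr)
    assume "\<not> ?thesis"
    hence "K \<subseteq> {\<one>}" by blast
    hence "card K \<le> 1" using card_mono[of "{\<one>}" K] by simp
    thus False using cardK[OF that] q by simp
  qed
  have PK: "K \<in> \<K>" if "P \<in> \<Psi>" "K \<in> P" for K P
    using part that unfolding partition_on_def by blast
  have partP: "partition_on ?C \<P>"
  proof (rule partition_onI)
    show "\<Union>\<P> = ?C"
    proof
      show "\<Union>\<P> \<subseteq> ?C" unfolding \<P>_def using PK KC by fastforce
      show "?C \<subseteq> \<Union>\<P>"
      proof
        fix x assume "x \<in> ?C"
        then obtain K where K: "K \<in> \<K>" "x \<in> K" using cover by blast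
        then obtain P where "P \<in> \<Psi>" "K \<in> P" using part unfolding partition_on_def by blast
        thus "x \<in> \<Union>\<P>" using K unfolding \<P>_def by (cases "x = \<one>") auto
      qed
    qed
    show "disjnt p r" if "p \<in> \<P>" "r \<in> \<P>" "p \<noteq> r" for p r
    proof -
      have "(\<Union>K\<in>P. K - {\<one>}) \<inter> (\<Union>K\<in>Q. K - {\<one>}) = {}" if "P \<in> \<Psi>" "Q \<in> \<Psi>" "P \<noteq> Q" for P Q
      proof (rule ccontr)
        assume "\<not> ?thesis"
        then obtain x K M where "K \<in> P" "M \<in> Q" "x \<in> K" "x \<in> M" "x \<noteq> \<one>" by blast
        hence "K \<in> P \<inter> Q" using unq[of K M x] PK that by blast
        thus False using part that unfolding partition_on_def disjoint_def by blast
      qed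
      hence d: "disjnt (\<Union>K\<in>P. K - {\<one>}) (\<Union>K\<in>Q. K - {\<one>})"
        if "P \<in> \<Psi>" "Q \<in> \<Psi>" "P \<noteq> Q" for P Q
        using that unfolding disjnt_def by blast
      have e: "disjnt {\<one>} (\<Union>K\<in>P. K - {\<one>})" "disjnt (\<Union>K\<in>P. K - {\<one>}) {\<one>}" for P
        unfolding disjnt_def by blast+
      consider "p = {\<one>}" "r = {\<one>}" | P where "p = {\<one>}" "r = (\<Union>K\<in>P. K - {\<one>})"
        | P where "r = {\<one>}" "p = (\<Union>K\<in>P. K - {\<one>})"
        | P Q where "P \<in> \<Psi>" "Q \<in> \<Psi>" "p = (\<Union>K\<in>P. K - {\<one>})" "r = (\<Union>K\<in>Q. K - {\<one>})"
        using \<open>p \<in> \<P>\<close> \<open>r \<in> \<P>\<close> unfolding \<P>_def by (elim insertE imageE) metis+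
      thus ?thesis
      proof cases
        case 4
        thus ?thesis using d \<open>p \<noteq> r\<close> by metis
      qed (use e \<open>p \<noteq> r\<close> in simp_all)
    qed
    have ne: "p \<noteq> {}" if "p \<in> \<P>" for p
    proof -
      have "(\<Union>K\<in>P. K - {\<one>}) \<noteq> {}" if "P \<in> \<Psi>" for P
      proof -
        have "P \<noteq> {}" using part \<open>P \<in> \<Psi>\<close> unfolding partition_on_def by metis
        then obtain K where K: "K \<in> P" by blast
        then obtain x where "x \<in> K" "x \<noteq> \<one>" using nonid[OF PK[OF \<open>P \<in> \<Psi>\<close> K]] by blast
        thus ?thesis using K by blast
      qed
      thus ?thesis using that unfolding \<P>_def by (elim insertE imageE) simp_all
    qed
    show "{} \<notin> \<P>" using ne by blast
  qed
  have invP: "m_inv H ` X \<in> \<P>" if "X \<in> \<P>" for X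
  proof -
    have eq: "m_inv H ` (\<Union>K\<in>P. K - {\<one>}) = (\<Union>K\<in>P. K - {\<one>})" if P: "P \<in> \<Psi>" for P
    proof -
      have s: "inv x \<in> (\<Union>K\<in>P. K - {\<one>})" if x: "x \<in> (\<Union>K\<in>P. K - {\<one>})" for x
      proof -
        obtain K where K: "K \<in> P" "x \<in> K" "x \<noteq> \<one>" using x by blast
        have "inv x \<in> K" using sub[OF PK[OF P K(1)]] K(2) by (simp add: subgroup.m_inv_closed)
        moreover have "inv x \<noteq> \<one>"
          using K KC[OF PK[OF P K(1)]] inv_eq_1_iff by auto
        ultimately show ?thesis using K by blast
      qed
      have c: "x \<in> ?C" if "x \<in> (\<Union>K\<in>P. K - {\<one>})" for x using that PK[OF P] KC by blast
      show ?thesis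
      proof
        show "m_inv H ` (\<Union>K\<in>P. K - {\<one>}) \<subseteq> (\<Union>K\<in>P. K - {\<one>})" using s by blast
        show "(\<Union>K\<in>P. K - {\<one>}) \<subseteq> m_inv H ` (\<Union>K\<in>P. K - {\<one>})"
        proof
          fix x assume x: "x \<in> (\<Union>K\<in>P. K - {\<one>})"
          show "x \<in> m_inv H ` (\<Union>K\<in>P. K - {\<one>})"
            using s[OF x] c[OF x] by (intro image_eqI[of _ _ "inv x"]) auto
        qed
      qed
    qed
    show ?thesis using that unfolding \<P>_def
    proof (elim insertE imageE)
      fix P assume P: "P \<in> \<Psi>" "X = (\<Union>K\<in>P. K - {\<one>})"
      show "m_inv H ` X \<in> insert {\<one>} ((\<lambda>P. \<Union>K\<in>P. K - {\<one>}) ` \<Psi>)"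
        unfolding P(2) eq[OF P(1)] using P(1) by blast
    qed simp
  qed
  note iff = int_span_iff[OF partP H(2)]
  have outD: "f x = 0" if "f \<in> int_span \<P>" "x \<notin> ?C" for f x
    using that(1)[unfolded iff, THEN conjunct1] that(2) by metis
  have constD: "f x = f y" if "f \<in> int_span \<P>" "X \<in> \<P>" "x \<in> X" "y \<in> X" for f X x y
    using that(1)[unfolded iff, THEN conjunct2] that(2-4) by metis
  have blk: "f x = f y" if "f \<in> int_span \<P>" "P \<in> \<Psi>" "K \<in> P" "M \<in> P"
      "x \<in> K" "y \<in> M" "x \<noteq> \<one>" "y \<noteq> \<one>" for f P K M x y
  proof -
    have "(\<Union>K\<in>P. K - {\<one>}) \<in> \<P>" using that unfolding \<P>_def by blast
    moreover have "x \<in> (\<Union>K\<in>P. K - {\<one>})" "y \<in> (\<Union>K\<in>P. K - {\<one>})" using that by blast+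
    ultimately show ?thesis by (rule constD[OF that(1)])
  qed
  define rep where "rep K = (SOME x. x \<in> K \<and> x \<noteq> \<one>)" for K
  have rep: "rep K \<in> K" "rep K \<noteq> \<one>" if "K \<in> \<K>" for K
    using someI_ex[of "\<lambda>x. x \<in> K \<and> x \<noteq> \<one>"] nonid[OF that] unfolding rep_def by blast+
  have inK: "f x = f (rep K)" if "f \<in> int_span \<P>" "K \<in> \<K>" "x \<in> K" "x \<noteq> \<one>" for f x K
  proof -
    obtain P where "P \<in> \<Psi>" "K \<in> P"
      using part \<open>K \<in> \<K>\<close> unfolding partition_on_def by blast
    thus ?thesis using blk[OF that(1), of P K K x "rep K"] rep that by blast
  qed
  have ind: "(\<Sum>K\<in>\<K>. a K * indicator K x) = a K0" if "K0 \<in> \<K>" "x \<in> K0" "x \<noteq> \<one>"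
    for a :: "'a set \<Rightarrow> int" and x K0
  proof -
    have "(\<Sum>K\<in>\<K>. a K * indicator K x) = (\<Sum>K\<in>\<K>. if K = K0 then a K else 0)"
      using that unq by (intro sum.cong) (auto simp: indicator_def)
    thus ?thesis using fin that by simp
  qed
  have decomp: "f = (\<lambda>x. (f \<one> - (\<Sum>K\<in>\<K>. f (rep K))) * indicator {\<one>} x +
        (\<Sum>K\<in>\<K>. f (rep K) * indicator K x))" if f: "f \<in> int_span \<P>" for f
  proof
    fix x
    consider "x \<notin> ?C" | "x = \<one>" | K where "K \<in> \<K>" "x \<in> K" "x \<noteq> \<one>"
      using cover by blast
    thus "f x = (f \<one> - (\<Sum>K\<in>\<K>. f (rep K))) * indicator {\<one>} x +
        (\<Sum>K\<in>\<K>. f (rep K) * indicator K x)"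
    proof cases
      case 1
      moreover have "(\<Sum>K\<in>\<K>. f (rep K) * indicator K x) = 0"
        using 1 KC by (intro sum.neutral) (auto simp: indicator_def)
      ultimately show ?thesis using f iff by (auto simp: indicator_def)
    next
      case 2
      have "(\<Sum>K\<in>\<K>. f (rep K) * indicator K x) = (\<Sum>K\<in>\<K>. f (rep K))"
        using 2 oneK by (intro sum.cong) (auto simp: indicator_def)
      thus ?thesis using 2 by simp
    next
      case 3
      thus ?thesis using ind[OF 3, of "\<lambda>K. f (rep K)"] inK[OF f 3] by simp
    qed
  qed
  have KK: "(indicator K \<otimes>\<^bsub>?R\<^esub> indicator M) x = (if K = M then int q * indicator K x else 1)"
    if K: "K \<in> \<K>" and M: "M \<in> \<K>" and x: "x \<in> ?C" for K M x
  proof (cases "K = M")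
    case True
    let ?S = "{p \<in> K \<times> K. fst p \<otimes> snd p = x}"
    have "card ?S = (if x \<in> K then q else 0)"
    proof (cases "x \<in> K")
      case True
      have "bij_betw (\<lambda>y. (y, inv y \<otimes> x)) K ?S"
      proof (rule bij_betw_imageI)
        show "inj_on (\<lambda>y. (y, inv y \<otimes> x)) K" by (auto simp: inj_on_def)
        show "(\<lambda>y. (y, inv y \<otimes> x)) ` K = ?S"
        proof
          show "(\<lambda>y. (y, inv y \<otimes> x)) ` K \<subseteq> ?S"
          proof clarify
            fix y assume y: "y \<in> K"
            have "inv y \<otimes> x \<in> K"
              using sub[OF K] y True by (simp add: subgroup.m_closed subgroup.m_inv_closed)
            moreover have "y \<otimes> (inv y \<otimes> x) = x"
              using KC[OF K] y x by (simp add: m_assoc[symmetric] subset_iff)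
            ultimately show "(y, inv y \<otimes> x) \<in> K \<times> K \<and> fst (y, inv y \<otimes> x) \<otimes> snd (y, inv y \<otimes> x) = x"
              using y by simp
          qed
          show "?S \<subseteq> (\<lambda>y. (y, inv y \<otimes> x)) ` K"
          proof
            fix p assume p: "p \<in> ?S"
            define y where "y = fst p"
            define z where "z = snd p"
            have yz: "p = (y, z)" "y \<in> K" "z \<in> K" "x = y \<otimes> z"
              using p by (auto simp: y_def z_def)
            have "inv y \<otimes> x = z"
              using KC[OF K] yz by (simp add: m_assoc[symmetric] subset_iff)
            thus "p \<in> (\<lambda>y. (y, inv y \<otimes> x)) ` K"
              using yz by (intro image_eqI[of _ _ y]) simp_all
          qed
        qed
      qed
      thus ?thesis using True cardK[OF K] by (simp add: bij_betw_same_card[symmetric])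
    next
      case False
      have e: "?S = {}" using False sub[OF K] by (auto simp: subgroup.m_closed)
      show ?thesis unfolding e using False by simp
    qed
    thus ?thesis using True mult_gr_indicator[OF H(2) KC[OF K] KC[OF K]] by simp
  next
    case False
    let ?m = "\<lambda>p. fst p \<otimes> snd p"
    have inj: "inj_on ?m (K \<times> M)"
    proof (rule inj_onI, clarsimp)
      fix y z y' z'
      assume a: "y \<in> K" "z \<in> M" "y' \<in> K" "z' \<in> M" "y \<otimes> z = y' \<otimes> z'"
      have c: "y \<in> ?C" "z \<in> ?C" "y' \<in> ?C" "z' \<in> ?C" using a KC[OF K] KC[OF M] by auto
      have "inv y' \<otimes> y = z' \<otimes> inv z"
      proof -
        have "inv y' \<otimes> y = inv y' \<otimes> (y \<otimes> z) \<otimes> inv z" using c by (simp add: m_assoc)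
        also have "\<dots> = inv y' \<otimes> (y' \<otimes> z') \<otimes> inv z" using a by simp
        also have "\<dots> = z' \<otimes> inv z" using c by (simp add: m_assoc[symmetric])
        finally show ?thesis .
      qed
      moreover have "inv y' \<otimes> y \<in> K" "z' \<otimes> inv z \<in> M"
        using a sub[OF K] sub[OF M] by (simp_all add: subgroup.m_closed subgroup.m_inv_closed)
      ultimately have e: "inv y' \<otimes> y = \<one>" "z' \<otimes> inv z = \<one>"
        using triv[OF K M False] by auto
      have "inv y = inv y'" using inv_equality[OF e(1)] c by simp
      hence "y = y'" using c by (metis inv_inv)
      moreover have "z = z'" using inv_equality[OF e(2)] c by simp
      ultimately show "y = y' \<and> z = z'" by blast
    qed
    have "card (?m ` (K \<times> M)) = card ?C"
      using card_image[OF inj] H(3) cardK[OF K] cardK[OF M] by (simp add: card_cartesian_product)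
    moreover have "?m ` (K \<times> M) \<subseteq> ?C" using KC[OF K] KC[OF M] by (auto simp: subset_iff)
    ultimately have "?m ` (K \<times> M) = ?C" using H(2) by (meson card_subset_eq)
    then obtain p where p: "p \<in> K \<times> M" "x = ?m p" using x by blast
    have e: "{p \<in> K \<times> M. ?m p = x} = {p}"
    proof
      show "{p \<in> K \<times> M. ?m p = x} \<subseteq> {p}"
      proof
        fix r assume "r \<in> {p \<in> K \<times> M. ?m p = x}"
        hence "r \<in> K \<times> M" "?m r = ?m p" using p(2) by simp_all
        thus "r \<in> {p}" using inj_onD[OF inj] p(1) by blast
      qed
      show "{p} \<subseteq> {p \<in> K \<times> M. ?m p = x}" using p by simp
    qed
    show ?thesis
      using False unfolding mult_gr_indicator[OF H(2) KC[OF K] KC[OF M], of x] e by simp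
  qed
  have conv: "(f \<otimes>\<^bsub>?R\<^esub> g) x =
      (f \<one> - (\<Sum>K\<in>\<K>. f (rep K))) * g (rep K0) + (g \<one> - (\<Sum>K\<in>\<K>. g (rep K))) * f (rep K0)
      + (\<Sum>K\<in>\<K>. \<Sum>M\<in>\<K>. f (rep K) * g (rep M)) - (\<Sum>K\<in>\<K>. f (rep K) * g (rep K))
      + int q * f (rep K0) * g (rep K0)"
    if f: "f \<in> int_span \<P>" and g: "g \<in> int_span \<P>"
      and K0: "K0 \<in> \<K>" "x \<in> K0" "x \<noteq> \<one>" for f g x K0
  proof -
    define a where "a K = f (rep K)" for K
    define b where "b K = g (rep K)" for K
    define c where "c = f \<one> - (\<Sum>K\<in>\<K>. a K)"
    define d where "d = g \<one> - (\<Sum>K\<in>\<K>. b K)"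
    define fs where "fs = (\<lambda>x. \<Sum>K\<in>\<K>. a K * indicator K x)"
    define gs where "gs = (\<lambda>x. \<Sum>K\<in>\<K>. b K * indicator K x)"
    have x: "x \<in> ?C" using K0 KC by blast
    have sc: "(\<lambda>x. k * \<one>\<^bsub>?R\<^esub> x) \<in> carrier ?R" for k
      by (auto simp: one_gr carrier_gr indicator_def)
    have fsc: "fs \<in> carrier ?R" "gs \<in> carrier ?R"
      unfolding fs_def gs_def carrier_gr using cover by (auto intro!: sum.neutral simp: indicator_def)
    have fd: "f = (\<lambda>x. c * \<one>\<^bsub>?R\<^esub> x) \<oplus>\<^bsub>?R\<^esub> fs"
      unfolding one_gr add_gr fs_def a_def c_def by (rule decomp[OF f])
    have gd: "g = (\<lambda>x. d * \<one>\<^bsub>?R\<^esub> x) \<oplus>\<^bsub>?R\<^esub> gs"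
      unfolding one_gr add_gr gs_def b_def d_def by (rule decomp[OF g])
    have gc: "g \<in> carrier ?R" using g iff unfolding carrier_gr by blast
    have left: "(\<lambda>x. k * \<one>\<^bsub>?R\<^esub> x) \<otimes>\<^bsub>?R\<^esub> h = (\<lambda>x. k * h x)" if "h \<in> carrier ?R" for k h
      unfolding mult_gr_scale_left R.l_one[OF that] ..
    have right: "h \<otimes>\<^bsub>?R\<^esub> (\<lambda>x. k * \<one>\<^bsub>?R\<^esub> x) = (\<lambda>x. k * h x)" if "h \<in> carrier ?R" for k h
      unfolding mult_gr_scale_right R.r_one[OF that] ..
    have "f \<otimes>\<^bsub>?R\<^esub> g = (\<lambda>x. c * \<one>\<^bsub>?R\<^esub> x) \<otimes>\<^bsub>?R\<^esub> g \<oplus>\<^bsub>?R\<^esub> fs \<otimes>\<^bsub>?R\<^esub> g"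
      by (subst fd, rule R.l_distr) (use sc fsc gc in auto)
    also have "fs \<otimes>\<^bsub>?R\<^esub> g = fs \<otimes>\<^bsub>?R\<^esub> (\<lambda>x. d * \<one>\<^bsub>?R\<^esub> x) \<oplus>\<^bsub>?R\<^esub> fs \<otimes>\<^bsub>?R\<^esub> gs"
      by (subst gd, rule R.r_distr) (use sc fsc in auto)
    finally have "(f \<otimes>\<^bsub>?R\<^esub> g) x = c * g x + d * fs x + (fs \<otimes>\<^bsub>?R\<^esub> gs) x"
      by (simp add: add_gr left[OF gc] right[OF fsc(1)])
    moreover have "g x = b K0" unfolding b_def by (rule inK[OF g K0])
    moreover have "fs x = a K0" unfolding fs_def by (rule ind[OF K0])
    moreover have "(fs \<otimes>\<^bsub>?R\<^esub> gs) x =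
        (\<Sum>K\<in>\<K>. \<Sum>M\<in>\<K>. a K * b M) - (\<Sum>K\<in>\<K>. a K * b K) + int q * a K0 * b K0"
    proof -
      have "(fs \<otimes>\<^bsub>?R\<^esub> gs) x =
          (\<Sum>K\<in>\<K>. a K * (\<Sum>M\<in>\<K>. b M * (if K = M then int q * indicator K x else 1)))"
        unfolding fs_def mult_gr_sum_left gs_def mult_gr_sum_right
        by (intro sum.cong refl arg_cong2[of _ _ _ _ "(*)"]) (auto simp: KK[OF _ _ x])
      also have "\<dots> = (\<Sum>K\<in>\<K>. (\<Sum>M\<in>\<K>. a K * b M)
          + (\<Sum>M\<in>\<K>. if M = K then a K * b K * (int q * indicator K x - 1) else 0))"
        unfolding sum.distrib[symmetric] sum_distrib_left
        by (intro sum.cong refl) (auto simp: algebra_simps)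
      also have "\<dots> = (\<Sum>K\<in>\<K>. \<Sum>M\<in>\<K>. a K * b M)
          + (\<Sum>K\<in>\<K>. (int q * a K * b K) * indicator K x - a K * b K)"
        unfolding sum.distrib by (simp add: fin algebra_simps)
      also have "\<dots> = (\<Sum>K\<in>\<K>. \<Sum>M\<in>\<K>. a K * b M) - (\<Sum>K\<in>\<K>. a K * b K) + int q * a K0 * b K0"
        unfolding sum_subtractf ind[OF K0] by simp
      finally show ?thesis .
    qed
    ultimately show ?thesis unfolding a_def b_def c_def d_def by simp
  qed
  have multc: "f \<otimes>\<^bsub>?R\<^esub> g \<in> int_span \<P>" if f: "f \<in> int_span \<P>" and g: "g \<in> int_span \<P>" for f g
    unfolding iff
  proof (intro conjI ballI)
    show "\<forall>x. x \<notin> ?C \<longrightarrow> (f \<otimes>\<^bsub>?R\<^esub> g) x = 0"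
      using mult_gr_closed[OF H(1)] unfolding carrier_gr by blast
    fix X x y assume X: "X \<in> \<P>" "x \<in> X" "y \<in> X"
    show "(f \<otimes>\<^bsub>?R\<^esub> g) x = (f \<otimes>\<^bsub>?R\<^esub> g) y"
    proof (cases "X = {\<one>}")
      case True
      thus ?thesis using X by simp
    next
      case False
      then obtain P where P: "P \<in> \<Psi>" "X = (\<Union>K\<in>P. K - {\<one>})" using X unfolding \<P>_def by blast
      obtain K where K: "K \<in> P" "x \<in> K" "x \<noteq> \<one>" using X P by blast
      obtain M where M: "M \<in> P" "y \<in> M" "y \<noteq> \<one>" using X P by blast
      have KM: "K \<in> \<K>" "M \<in> \<K>" using PK P K M by blast+
      have e: "h (rep K) = h (rep M)" if "h \<in> int_span \<P>" for h
        using blk[OF that P(1) K(1) M(1), of "rep K" "rep M"] rep KM by blast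
      show ?thesis
        unfolding conv[OF f g KM(1) K(2,3)] conv[OF f g KM(2) M(2,3)] e[OF f] e[OF g] ..
    qed
  qed
  have "subring (int_span \<P>) ?R"
  proof (rule R.subringI)
    show "int_span \<P> \<subseteq> carrier ?R" unfolding carrier_gr using iff by blast
    have "X = {\<one>} \<or> \<one> \<notin> X" if "X \<in> \<P>" for X
      using that unfolding \<P>_def by blast
    thus "\<one>\<^bsub>?R\<^esub> \<in> int_span \<P>"
      unfolding iff one_gr by (auto simp: indicator_def)
    show "\<ominus>\<^bsub>?R\<^esub> h \<in> int_span \<P>" if h: "h \<in> int_span \<P>" for h
    proof -
      have hc: "h \<in> carrier ?R" unfolding carrier_gr using h iff by blast
      have m: "\<ominus>\<^bsub>?R\<^esub> h = (\<lambda>x. - h x)"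
        by (rule R.minus_equality) (use hc in \<open>auto simp: add_gr zero_gr carrier_gr\<close>)
      show ?thesis unfolding iff m
        by (intro conjI allI impI ballI) (simp add: outD[OF h], metis constD[OF h])
    qed
    show "f \<oplus>\<^bsub>?R\<^esub> g \<in> int_span \<P>" if "f \<in> int_span \<P>" "g \<in> int_span \<P>" for f g
      unfolding iff add_gr
      by (intro conjI allI impI ballI)
        (simp add: outD[OF that(1)] outD[OF that(2)], metis constD[OF that(1)] constD[OF that(2)])
  qed (rule multc)
  thus ?thesis
    unfolding schur_ring_def using H partP invP by (auto simp: \<P>_def)
qed


lemma lines_eq_one_dim_subspaces:
  assumes "field F"
  shows "lines F =
    {{(c \<otimes>\<^bsub>F\<^esub> x, c \<otimes>\<^bsub>F\<^esub> y) | c. c \<in> carrier F} | x y.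
      x \<in> carrier F \<and> y \<in> carrier F \<and> (x, y) \<noteq> (\<zero>\<^bsub>F\<^esub>, \<zero>\<^bsub>F\<^esub>)}"
proof -
  interpret field F by fact
  let ?sp = "\<lambda>x y. {(c \<otimes>\<^bsub>F\<^esub> x, c \<otimes>\<^bsub>F\<^esub> y) | c. c \<in> carrier F}"
  have inf: "?sp \<zero>\<^bsub>F\<^esub> y = line F None" if "y \<in> carrier F" "y \<noteq> \<zero>\<^bsub>F\<^esub>" for y
  proof -
    have "(\<exists>c. x = c \<otimes>\<^bsub>F\<^esub> y \<and> c \<in> carrier F) \<longleftrightarrow> x \<in> carrier F" for x
    proof
      assume x: "x \<in> carrier F"
      have iy: "inv\<^bsub>F\<^esub> y \<in> carrier F" "inv\<^bsub>F\<^esub> y \<otimes>\<^bsub>F\<^esub> y = \<one>\<^bsub>F\<^esub>"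
        using that field_Units by auto
      thus "\<exists>c. x = c \<otimes>\<^bsub>F\<^esub> y \<and> c \<in> carrier F"
        using x that by (intro exI[of _ "x \<otimes>\<^bsub>F\<^esub> inv\<^bsub>F\<^esub> y"]) (simp add: m_assoc)
    qed (use that in auto)
    hence e: "{c \<otimes>\<^bsub>F\<^esub> y | c. c \<in> carrier F} = carrier F" by blast
    have "?sp \<zero>\<^bsub>F\<^esub> y = Pair \<zero>\<^bsub>F\<^esub> ` {c \<otimes>\<^bsub>F\<^esub> y | c. c \<in> carrier F}"
      by (auto; metis r_null)
    thus ?thesis unfolding e line_def by auto
  qed
  have fin: "?sp x y = line F (Some (y \<otimes>\<^bsub>F\<^esub> inv\<^bsub>F\<^esub> x))"
    if "x \<in> carrier F" "y \<in> carrier F" "x \<noteq> \<zero>\<^bsub>F\<^esub>" for x y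
  proof -
    have ix: "inv\<^bsub>F\<^esub> x \<in> carrier F" "inv\<^bsub>F\<^esub> x \<otimes>\<^bsub>F\<^esub> x = \<one>\<^bsub>F\<^esub>"
      using that field_Units by auto
    show ?thesis
    proof
      show "?sp x y \<subseteq> line F (Some (y \<otimes>\<^bsub>F\<^esub> inv\<^bsub>F\<^esub> x))"
      proof clarify
        fix c assume c: "c \<in> carrier F"
        have "(y \<otimes>\<^bsub>F\<^esub> inv\<^bsub>F\<^esub> x) \<otimes>\<^bsub>F\<^esub> (c \<otimes>\<^bsub>F\<^esub> x) = c \<otimes>\<^bsub>F\<^esub> y \<otimes>\<^bsub>F\<^esub> (inv\<^bsub>F\<^esub> x \<otimes>\<^bsub>F\<^esub> x)"
          using that c ix(1) by (simp add: m_ac)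
        also have "\<dots> = c \<otimes>\<^bsub>F\<^esub> y" using that c ix by simp
        finally have "c \<otimes>\<^bsub>F\<^esub> y = (y \<otimes>\<^bsub>F\<^esub> inv\<^bsub>F\<^esub> x) \<otimes>\<^bsub>F\<^esub> (c \<otimes>\<^bsub>F\<^esub> x)" ..
        moreover have "c \<otimes>\<^bsub>F\<^esub> x \<in> carrier F" using that c by simp
        ultimately show "(c \<otimes>\<^bsub>F\<^esub> x, c \<otimes>\<^bsub>F\<^esub> y) \<in> line F (Some (y \<otimes>\<^bsub>F\<^esub> inv\<^bsub>F\<^esub> x))"
          unfolding line_def option.case by blast
      qed
      show "line F (Some (y \<otimes>\<^bsub>F\<^esub> inv\<^bsub>F\<^esub> x)) \<subseteq> ?sp x y"
      proof
        fix p assume "p \<in> line F (Some (y \<otimes>\<^bsub>F\<^esub> inv\<^bsub>F\<^esub> x))"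
        then obtain t where t: "t \<in> carrier F" "p = (t, (y \<otimes>\<^bsub>F\<^esub> inv\<^bsub>F\<^esub> x) \<otimes>\<^bsub>F\<^esub> t)"
          unfolding line_def by auto
        define c where "c = t \<otimes>\<^bsub>F\<^esub> inv\<^bsub>F\<^esub> x"
        have "c \<in> carrier F" using t ix by (simp add: c_def)
        moreover have "c \<otimes>\<^bsub>F\<^esub> x = t" using t ix that by (simp add: c_def m_assoc)
        moreover have "c \<otimes>\<^bsub>F\<^esub> y = (y \<otimes>\<^bsub>F\<^esub> inv\<^bsub>F\<^esub> x) \<otimes>\<^bsub>F\<^esub> t"
          using t ix(1) that by (simp add: c_def m_ac)
        ultimately show "p \<in> ?sp x y" using t(2) by (intro CollectI exI[of _ c]) simp
      qed
    qed
  qed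
  show ?thesis
  proof
    show "lines F \<subseteq> {?sp x y | x y.
      x \<in> carrier F \<and> y \<in> carrier F \<and> (x, y) \<noteq> (\<zero>\<^bsub>F\<^esub>, \<zero>\<^bsub>F\<^esub>)}"
    proof
      fix L assume "L \<in> lines F"
      then consider "L = line F None" | \<alpha> where "\<alpha> \<in> carrier F" "L = line F (Some \<alpha>)"
        unfolding lines_def slopes_def by blast
      thus "L \<in> {?sp x y | x y.
        x \<in> carrier F \<and> y \<in> carrier F \<and> (x, y) \<noteq> (\<zero>\<^bsub>F\<^esub>, \<zero>\<^bsub>F\<^esub>)}"
      proof cases
        case 1
        thus ?thesis using inf[of "\<one>\<^bsub>F\<^esub>"]
          by (intro CollectI exI[of _ "\<zero>\<^bsub>F\<^esub>"] exI[of _ "\<one>\<^bsub>F\<^esub>"]) simp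
      next
        case 2
        thus ?thesis using fin[of "\<one>\<^bsub>F\<^esub>" \<alpha>]
          by (intro CollectI exI[of _ "\<one>\<^bsub>F\<^esub>"] exI[of _ \<alpha>]) simp
      qed
    qed
    show "{?sp x y | x y.
      x \<in> carrier F \<and> y \<in> carrier F \<and> (x, y) \<noteq> (\<zero>\<^bsub>F\<^esub>, \<zero>\<^bsub>F\<^esub>)} \<subseteq> lines F"
    proof (rule subsetI, elim CollectE exE conjE, hypsubst)
      fix x y assume xy: "x \<in> carrier F" "y \<in> carrier F" "(x, y) \<noteq> (\<zero>\<^bsub>F\<^esub>, \<zero>\<^bsub>F\<^esub>)"
      show "?sp x y \<in> lines F"
      proof (cases "x = \<zero>\<^bsub>F\<^esub>")
        case True
        hence "?sp x y = line F None" using inf[of y] xy by simp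
        thus ?thesis unfolding lines_def slopes_def by blast
      next
        case False
        have "inv\<^bsub>F\<^esub> x \<in> carrier F" using False xy field_Units by auto
        thus ?thesis unfolding fin[OF xy(1,2) False] lines_def slopes_def using xy by blast
      qed
    qed
  qed
qed

theorem schur_ring_line_schur_ring:
  assumes F: "field F" "finite (carrier F)" and H: "group H"
    and \<rho>: "\<rho> \<in> iso (plane_group F) H" and part: "partition_on (lines F) \<pi>"
  shows "schur_ring H (line_basic_sets F \<rho> \<pi>) (line_schur_ring F \<rho> \<pi>)"
proof -
  interpret field F by fact
  let ?V = "plane_group F" and ?z = "(\<zero>\<^bsub>F\<^esub>, \<zero>\<^bsub>F\<^esub>)"
  have V: "group ?V" unfolding plane_group_def by (intro DirProd_group add.is_group)
  have cV: "carrier ?V = carrier F \<times> carrier F" by (simp add: plane_group_def)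
  have oV: "\<one>\<^bsub>?V\<^esub> = ?z" by (simp add: plane_group_def)
  have mV: "(x, y) \<otimes>\<^bsub>?V\<^esub> (x', y') = (x \<oplus>\<^bsub>F\<^esub> x', y \<oplus>\<^bsub>F\<^esub> y')" for x y x' y'
    by (simp add: plane_group_def)
  interpret hom: group_hom ?V H \<rho>
    using V H \<rho> by (simp add: group_hom_def group_hom_axioms_def iso_def)
  have bij: "bij_betw \<rho> (carrier F \<times> carrier F) (carrier H)"
    using \<rho> by (simp add: iso_def cV)
  hence inj: "inj_on \<rho> (carrier F \<times> carrier F)" and img: "\<rho> ` (carrier F \<times> carrier F) = carrier H"
    by (simp_all add: bij_betw_def)
  have rz: "\<rho> ?z = \<one>\<^bsub>H\<^esub>" using hom.hom_one by (simp add: oV)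
  have lc: "L \<subseteq> carrier F \<times> carrier F" if "L \<in> lines F" for L
    using that by (auto simp: lines_def slopes_def line_def)
  have lz: "?z \<in> L" if "L \<in> lines F" for L
    using that by (force simp: lines_def slopes_def line_def)
  have lsub: "subgroup L ?V" if "L \<in> lines F" for L
  proof (rule group.subgroupI[OF V])
    show "L \<subseteq> carrier ?V" using lc[OF that] by (simp add: cV)
    show "L \<noteq> {}" using lz[OF that] by blast
    consider "L = line F None" | \<alpha> where "\<alpha> \<in> carrier F" "L = line F (Some \<alpha>)"
      using \<open>L \<in> lines F\<close> unfolding lines_def slopes_def by blast
    hence "(\<forall>p\<in>L. inv\<^bsub>?V\<^esub> p \<in> L) \<and> (\<forall>p\<in>L. \<forall>r\<in>L. p \<otimes>\<^bsub>?V\<^esub> r \<in> L)"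
    proof cases
      case 1
      have "inv\<^bsub>?V\<^esub> (\<zero>\<^bsub>F\<^esub>, x) = (\<zero>\<^bsub>F\<^esub>, \<ominus>\<^bsub>F\<^esub> x)" if "x \<in> carrier F" for x
        by (rule group.inv_equality[OF V]) (use that in \<open>auto simp: mV oV cV l_neg\<close>)
      thus ?thesis unfolding 1 line_def by (auto simp: mV)
    next
      case 2
      have "inv\<^bsub>?V\<^esub> (x, \<alpha> \<otimes>\<^bsub>F\<^esub> x) = (\<ominus>\<^bsub>F\<^esub> x, \<alpha> \<otimes>\<^bsub>F\<^esub> (\<ominus>\<^bsub>F\<^esub> x))" if "x \<in> carrier F" for x
        by (rule group.inv_equality[OF V]) (use that 2 in \<open>auto simp: mV oV cV l_neg r_minus\<close>)
      thus ?thesis unfolding 2(2) line_def using 2(1) by (auto simp: mV r_distr)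
    qed
    thus "\<And>p. p \<in> L \<Longrightarrow> inv\<^bsub>?V\<^esub> p \<in> L" "\<And>p r. p \<in> L \<Longrightarrow> r \<in> L \<Longrightarrow> p \<otimes>\<^bsub>?V\<^esub> r \<in> L"
      by blast+
  qed
  have lcard: "card L = card (carrier F)" if "L \<in> lines F" for L
  proof -
    have "line F None = (\<lambda>x. (\<zero>\<^bsub>F\<^esub>, x)) ` carrier F"
      "line F (Some \<alpha>) = (\<lambda>x. (x, \<alpha> \<otimes>\<^bsub>F\<^esub> x)) ` carrier F" for \<alpha>
      by (auto simp: line_def)
    moreover have "inj_on (\<lambda>x. (\<zero>\<^bsub>F\<^esub>, x)) (carrier F)"
      "inj_on (\<lambda>x. (x, \<alpha> \<otimes>\<^bsub>F\<^esub> x)) (carrier F)" for \<alpha>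
      by (auto simp: inj_on_def)
    ultimately show ?thesis using that by (auto simp: lines_def slopes_def card_image)
  qed
  have ltriv: "L = M" if L: "L \<in> lines F" "M \<in> lines F" and p: "p \<in> L" "p \<in> M" "p \<noteq> ?z" for L M p
  proof -
    have canc: "\<alpha> = \<beta>" if "\<alpha> \<in> carrier F" "\<beta> \<in> carrier F" "x \<in> carrier F" "x \<noteq> \<zero>\<^bsub>F\<^esub>"
      "\<alpha> \<otimes>\<^bsub>F\<^esub> x = \<beta> \<otimes>\<^bsub>F\<^esub> x" for \<alpha> \<beta> x
      using m_rcancel[of x \<alpha> \<beta>] that by simp
    have None: "fst p = \<zero>\<^bsub>F\<^esub>" if "p \<in> line F None"
      using that by (auto simp: line_def)
    have Some: "\<alpha> \<in> carrier F" "fst p \<in> carrier F" "snd p = \<alpha> \<otimes>\<^bsub>F\<^esub> fst p" "fst p \<noteq> \<zero>\<^bsub>F\<^esub>"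
      if "Some \<alpha> \<in> slopes F" "p \<in> line F (Some \<alpha>)" for \<alpha>
    proof -
      show a: "\<alpha> \<in> carrier F" using that(1) by (auto simp: slopes_def)
      show b: "fst p \<in> carrier F" "snd p = \<alpha> \<otimes>\<^bsub>F\<^esub> fst p" using that(2) by (auto simp: line_def)
      show "fst p \<noteq> \<zero>\<^bsub>F\<^esub>"
      proof
        assume "fst p = \<zero>\<^bsub>F\<^esub>"
        hence "p = ?z" using a b by (simp add: prod_eq_iff)
        thus False using p(3) by simp
      qed
    qed
    have s: "s = t" if st: "s \<in> slopes F" "t \<in> slopes F" "p \<in> line F s" "p \<in> line F t" for s t
    proof (cases s; cases t)
      fix \<alpha> \<beta> assume e: "s = Some \<alpha>" "t = Some \<beta>"
      have "\<alpha> = \<beta>"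
        using canc[of \<alpha> \<beta> "fst p"] Some[of \<alpha>] Some[of \<beta>] st unfolding e by metis
      thus "s = t" using e by simp
    next
      fix \<alpha> assume "s = None" "t = Some \<alpha>"
      thus "s = t" using None Some(4)[of \<alpha>] st by simp
    next
      fix \<alpha> assume "s = Some \<alpha>" "t = None"
      thus "s = t" using None Some(4)[of \<alpha>] st by simp
    qed simp
    obtain s t where "s \<in> slopes F" "t \<in> slopes F" "L = line F s" "M = line F t"
      using L unfolding lines_def by blast
    thus ?thesis using s[of s t] p by simp
  qed
  have lcov: "\<exists>L\<in>lines F. p \<in> L" if p: "p \<in> carrier F \<times> carrier F" for p
  proof -
    obtain x y where xy: "p = (x, y)" "x \<in> carrier F" "y \<in> carrier F" using p by blast
    show ?thesis
    proof (cases "x = \<zero>\<^bsub>F\<^esub>")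
      case True
      hence "p \<in> line F None" using xy by (simp add: line_def)
      thus ?thesis unfolding lines_def slopes_def by blast
    next
      case False
      have ix: "inv\<^bsub>F\<^esub> x \<in> carrier F" "inv\<^bsub>F\<^esub> x \<otimes>\<^bsub>F\<^esub> x = \<one>\<^bsub>F\<^esub>"
        using xy False field_Units by auto
      have "p \<in> line F (Some (y \<otimes>\<^bsub>F\<^esub> inv\<^bsub>F\<^esub> x))"
        using xy ix by (simp add: line_def m_assoc)
      moreover have "y \<otimes>\<^bsub>F\<^esub> inv\<^bsub>F\<^esub> x \<in> carrier F" using xy ix by simp
      ultimately show ?thesis unfolding lines_def slopes_def by blast
    qed
  qed
  have injl: "inj_on ((`) \<rho>) (lines F)"
    by (rule inj_onI, rule inj_on_image_eq_iff[OF inj, THEN iffD1]) (use lc in auto)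
  let ?\<psi> = "(`) ((`) \<rho>) ` \<pi>"
  have diff: "\<rho> ` L - {\<one>\<^bsub>H\<^esub>} = \<rho> ` (L - {?z})" if "L \<in> lines F" for L
    using inj_on_image_set_diff[OF inj, of L "{?z}"] lc[OF that] by (auto simp: rz)
  have blocks: "(\<Union>K\<in>(`) \<rho> ` P. K - {\<one>\<^bsub>H\<^esub>}) = \<rho> ` punctured_union F P" if "P \<in> \<pi>" for P
  proof -
    have "L \<in> lines F" if "L \<in> P" for L
      using \<open>P \<in> \<pi>\<close> that part unfolding partition_on_def by blast
    hence "(\<Union>L\<in>P. \<rho> ` L - {\<one>\<^bsub>H\<^esub>}) = (\<Union>L\<in>P. \<rho> ` (L - {?z}))"
      by (intro SUP_cong refl diff)
    moreover have "(\<Union>K\<in>(`) \<rho> ` P. K - {\<one>\<^bsub>H\<^esub>}) = (\<Union>L\<in>P. \<rho> ` L - {\<one>\<^bsub>H\<^esub>})" by blast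
    ultimately show ?thesis unfolding punctured_union_def image_UN by (rule trans[rotated])
  qed
  have "schur_ring H (insert {\<one>\<^bsub>H\<^esub>} ((\<lambda>P. \<Union>K\<in>P. K - {\<one>\<^bsub>H\<^esub>}) ` ?\<psi>))
     (int_span (insert {\<one>\<^bsub>H\<^esub>} ((\<lambda>P. \<Union>K\<in>P. K - {\<one>\<^bsub>H\<^esub>}) ` ?\<psi>)))"
  proof (rule schur_ring_spread[where q = "card (carrier F)" and \<K> = "(`) \<rho> ` lines F"])
    show "group H" by fact
    show "finite (carrier H)" using bij F(2) bij_betw_finite by blast
    show "card (carrier H) = card (carrier F) * card (carrier F)"
      using bij_betw_same_card[OF bij] by (simp add: card_cartesian_product)
    have "card {\<zero>\<^bsub>F\<^esub>, \<one>\<^bsub>F\<^esub>} \<le> card (carrier F)" by (rule card_mono) (use F in auto)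
    thus "2 \<le> card (carrier F)" by simp
    show "subgroup K H" if "K \<in> (`) \<rho> ` lines F" for K
      using that lsub hom.subgroup_img_is_subgroup by blast
    show "card K = card (carrier F)" if "K \<in> (`) \<rho> ` lines F" for K
    proof -
      obtain L where L: "L \<in> lines F" "K = \<rho> ` L"
        using \<open>K \<in> (`) \<rho> ` lines F\<close> by blast
      show ?thesis using card_image[OF inj_on_subset[OF inj lc[OF L(1)]]] lcard[OF L(1)] L(2) by simp
    qed
    show "K \<inter> M = {\<one>\<^bsub>H\<^esub>}"
      if K: "K \<in> (`) \<rho> ` lines F" "M \<in> (`) \<rho> ` lines F" "K \<noteq> M" for K M
    proof -
      obtain L N where L: "L \<in> lines F" "K = \<rho> ` L" "N \<in> lines F" "M = \<rho> ` N"
        using K by blast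
      have "L \<noteq> N" using L K(3) by blast
      hence "L \<inter> N = {?z}" using ltriv[OF L(1,3)] lz L by blast
      thus ?thesis using inj_on_image_Int[OF inj lc[OF L(1)] lc[OF L(3)]] L rz by simp
    qed
    have "\<Union>(lines F) = carrier F \<times> carrier F" using lc lcov by blast
    thus "\<Union>((`) \<rho> ` lines F) = carrier H" using img by (metis image_Union)
    have "partition_on ((`) \<rho> ` lines F) (?\<psi> - {{}})"
      by (rule partition_on_inj_image[OF part injl])
    moreover have "{} \<notin> ?\<psi>" using part unfolding partition_on_def by blast
    ultimately show "partition_on ((`) \<rho> ` lines F) ?\<psi>" by simp
  qed
  moreover have "insert {\<one>\<^bsub>H\<^esub>} ((\<lambda>P. \<Union>K\<in>P. K - {\<one>\<^bsub>H\<^esub>}) ` ?\<psi>) = line_basic_sets F \<rho> \<pi>"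
    unfolding line_basic_sets_def rz image_image[of "\<lambda>P. \<Union>K\<in>P. K - {\<one>\<^bsub>H\<^esub>}"]
    by (rule arg_cong[where f = "insert {\<one>\<^bsub>H\<^esub>}"], rule image_cong[OF refl], rule blocks)
  ultimately show ?thesis unfolding line_schur_ring_def by simp
qed

end

theory Submission
  imports Defs
begin

text \<open>
  Let a permutation group \<open>G\<close> containing the translations realize the Schur ring, so that the
  basic sets are the orbits of the stabilizer \<open>S\<close> of the identity; view \<open>S\<close> as acting on the
  plane \<open>F \<times> F\<close>. If \<open>{L}\<close> is a class of the partition, then every element of \<open>S\<close> maps \<open>L\<close> into
  itself. Conjugating by translations (\<open>stabilizer_realizes_quotient\<close>) turns this into a statement
  about all parallels of \<open>L\<close>: the elements of \<open>S\<close> map points on a common parallel of \<open>L\<close> to points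
  on a common parallel of \<open>L\<close>.

  This applies to the slopes \<open>\<infinity>\<close>, \<open>0\<close> and \<open>1\<close>. The 3-net of these three directions is the net of
  the group \<open>(F, +)\<close>, and the only maps that preserve each direction and fix the origin are the maps
  \<open>(x, y) \<mapsto> (\<phi> x, \<phi> y)\<close> with \<open>\<phi>\<close> additive (\<open>three_directions_imp_diagonal_additive\<close>). Such a map
  preserves \<open>L\<^sub>\<alpha>\<close> exactly if \<open>\<phi>\<close> commutes with multiplication by \<open>\<alpha>\<close>, and the \<open>\<alpha>\<close> with which all
  the \<open>\<phi>\<close> commute form a subfield \<open>K\<close> (\<open>subfield_commuting_scalars\<close>).

  Every finite slope of a singleton class lies in \<open>K\<close>. Conversely, if \<open>\<alpha> \<in> K\<close>, then \<open>S\<close> preserves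
  \<open>L\<^sub>\<alpha>\<close>, so the \<open>S\<close>-orbit of a nonzero point of \<open>L\<^sub>\<alpha>\<close> stays inside \<open>L\<^sub>\<alpha>\<close>; as this orbit is a basic set, the
  class of \<open>L\<^sub>\<alpha>\<close> is \<open>{L\<^sub>\<alpha>}\<close>. Hence the finite slopes of the singleton classes are exactly the
  subfield \<open>K\<close>, contrary to the assumption.
\<close>

section \<open>Permutation groups containing the translations\<close>

text \<open>
  Composing \<open>g\<close> with the translations that take \<open>\<one>\<close> to \<open>x\<close> and \<open>g x\<close> back to \<open>\<one>\<close> gives an
  element that fixes \<open>\<one>\<close>. Hence, if the point stabilizer preserves a set \<open>X\<close>, then \<open>G\<close> preserves the
  relation \<open>y x\<^sup>-\<^sup>1 \<in> X\<close>.
\<close>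

lemma stabilizer_realizes_quotient:
  fixes H (structure)
  assumes "group H" and G: "subgroup G (BijGroup (carrier H))" and tr: "translation_perms H \<subseteq> G"
    and g: "g \<in> G" and xy: "x \<in> carrier H" "y \<in> carrier H"
  shows "\<exists>h\<in>point_stabilizer H G. h (y \<otimes> inv x) = g y \<otimes> inv (g x)"
proof -
  interpret group H by fact
  let ?B = "BijGroup (carrier H)"
  let ?t = "\<lambda>a. \<lambda>z\<in>carrier H. z \<otimes> a"
  have GB: "G \<subseteq> Bij (carrier H)"
    using subgroup.subset[OF G] by (simp add: BijGroup_def)
  have gmap: "g z \<in> carrier H" if "z \<in> carrier H" for z
    using Bij_imp_funcset[of g "carrier H"] GB g that by blast
  have tG: "?t a \<in> G" if "a \<in> carrier H" for a
    using tr that unfolding translation_perms_def by blast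
  define h where "h = ?t (inv (g x)) \<otimes>\<^bsub>?B\<^esub> (g \<otimes>\<^bsub>?B\<^esub> ?t x)"
  have hG: "h \<in> G"
    unfolding h_def using tG gmap xy g G by (intro subgroup.m_closed) auto
  have hz: "h z = g (z \<otimes> x) \<otimes> inv (g x)" if "z \<in> carrier H" for z
  proof -
    have "?t x \<in> Bij (carrier H)" "?t (inv (g x)) \<in> Bij (carrier H)" "g \<in> Bij (carrier H)"
      using tG gmap xy g GB by auto
    thus ?thesis
      using that xy gmap unfolding h_def BijGroup_def
      by (simp add: compose_Bij) (simp add: compose_def)
  qed
  have "h \<one> = \<one>" using hz[of \<one>] xy gmap by simp
  hence "h \<in> point_stabilizer H G"
    using hG unfolding point_stabilizer_def stabilizer_def by simp
  moreover have "h (y \<otimes> inv x) = g y \<otimes> inv (g x)"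
    using hz[of "y \<otimes> inv x"] xy by (simp add: m_assoc)
  ultimately show ?thesis by blast
qed

lemma block_eq_orbit:
  assumes G: "subgroup G (BijGroup (carrier H))" and "group H"
    and part: "partition_on (carrier H) \<P>"
    and orb: "\<P> = orbits (BijGroup (carrier H)\<lparr>carrier := point_stabilizer H G\<rparr>)
                   (carrier H) (\<lambda>g. g)"
    and X: "X \<in> \<P>" "x \<in> X"
  shows "X = {h x | h. h \<in> point_stabilizer H G}"
proof -
  interpret group H by fact
  let ?O = "{h x | h. h \<in> point_stabilizer H G}"
  have xH: "x \<in> carrier H" using X part unfolding partition_on_def by blast
  have "(\<lambda>z\<in>carrier H. z) \<in> G" using subgroup.one_closed[OF G] by (simp add: BijGroup_def)
  hence "(\<lambda>z\<in>carrier H. z) \<in> point_stabilizer H G"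
    unfolding point_stabilizer_def stabilizer_def by simp
  hence "x \<in> ?O" using xH by (intro CollectI exI[of _ "\<lambda>z\<in>carrier H. z"]) simp
  moreover have "?O \<in> \<P>" using xH unfolding orb orbits_def orbit_def by auto
  ultimately have "?O \<in> \<P>" "x \<in> X \<inter> ?O" using X(2) by auto
  moreover have "disjoint \<P>" using part by (simp add: partition_on_def)
  ultimately show ?thesis using disjointD[of \<P> X ?O] X(1) by blast
qed

section \<open>Maps of the plane that preserve parallelism\<close>

text \<open>
  Two points have their difference in the line of slope \<open>s\<close> if and only if they lie on a common
  parallel of that line, so this says that \<open>f\<close> maps each parallel into some parallel.
\<close>

definition preserves_direction ::
    "('a, 'm) ring_scheme \<Rightarrow> 'a option \<Rightarrow> ('a \<times> 'a \<Rightarrow> 'a \<times> 'a) \<Rightarrow> bool" where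
  "preserves_direction F s f \<longleftrightarrow>
     (\<forall>p\<in>carrier (plane_group F). \<forall>r\<in>carrier (plane_group F).
        p \<otimes>\<^bsub>plane_group F\<^esub> inv\<^bsub>plane_group F\<^esub> r \<in> line F s \<longrightarrow>
        f p \<otimes>\<^bsub>plane_group F\<^esub> inv\<^bsub>plane_group F\<^esub> f r \<in> line F s)"

lemma (in ring) plane_group_simps:
  "group (plane_group R)"
  "carrier (plane_group R) = carrier R \<times> carrier R"
  "\<one>\<^bsub>plane_group R\<^esub> = (\<zero>, \<zero>)"
  unfolding plane_group_def by (rule DirProd_group[OF add.is_group add.is_group]) simp_all

lemma (in ring) plane_group_diff:
  assumes "x \<in> carrier R" "y \<in> carrier R" "x' \<in> carrier R" "y' \<in> carrier R"
  shows "(x, y) \<otimes>\<^bsub>plane_group R\<^esub> inv\<^bsub>plane_group R\<^esub> (x', y') = (x \<ominus> x', y \<ominus> y')"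
  using assms unfolding plane_group_def
  by (simp add: inv_DirProd[OF add.is_group add.is_group] a_minus_def a_inv_def)

lemma (in cring) mem_line:
  shows "(x, y) \<in> line R None \<longleftrightarrow> x = \<zero> \<and> y \<in> carrier R"
    and "(x, y) \<in> line R (Some \<alpha>) \<longleftrightarrow> x \<in> carrier R \<and> y = \<alpha> \<otimes> x"
  by (auto simp: line_def)

text \<open>
  The directions \<open>\<infinity>\<close> and \<open>0\<close> make the first coordinate of the image a function \<open>\<phi>\<close> of \<open>x\<close> alone
  and the second a function \<open>\<psi>\<close> of \<open>y\<close> alone. The direction \<open>1\<close> says that
  \<open>\<psi> y - \<psi> y' = \<phi> x - \<phi> x'\<close> whenever \<open>y - y' = x - x'\<close>: comparing with the origin gives
  \<open>\<psi> = \<phi>\<close>, and then the equation is additivity.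
\<close>

lemma (in cring) three_directions_imp_diagonal_additive:
  assumes f: "f \<in> carrier R \<times> carrier R \<rightarrow> carrier R \<times> carrier R" and f0: "f (\<zero>, \<zero>) = (\<zero>, \<zero>)"
    and dir: "preserves_direction R None f" "preserves_direction R (Some \<zero>) f"
      "preserves_direction R (Some \<one>) f"
  defines "\<phi> \<equiv> \<lambda>x. fst (f (x, \<zero>))"
  shows "\<phi> \<in> carrier R \<rightarrow> carrier R"
    and "\<And>x y. x \<in> carrier R \<Longrightarrow> y \<in> carrier R \<Longrightarrow> f (x, y) = (\<phi> x, \<phi> y)"
    and "\<And>x y. x \<in> carrier R \<Longrightarrow> y \<in> carrier R \<Longrightarrow> \<phi> (x \<oplus> y) = \<phi> x \<oplus> \<phi> y"
proof -
  define \<psi> where "\<psi> y = snd (f (\<zero>, y))" for y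
  show c: "\<phi> \<in> carrier R \<rightarrow> carrier R" using f unfolding \<phi>_def by (auto simp: Pi_iff mem_Times_iff)
  have c': "\<psi> \<in> carrier R \<rightarrow> carrier R" using f unfolding \<psi>_def by (auto simp: Pi_iff mem_Times_iff)
  have fc: "fst (f (x, y)) \<in> carrier R" "snd (f (x, y)) \<in> carrier R"
    if "x \<in> carrier R" "y \<in> carrier R" for x y
    using f that by (auto simp: Pi_iff mem_Times_iff)
  have D: "(fst (f (x, y)) \<ominus> fst (f (x', y')), snd (f (x, y)) \<ominus> snd (f (x', y'))) \<in> line R s"
    if "preserves_direction R s f" "(x \<ominus> x', y \<ominus> y') \<in> line R s"
      "x \<in> carrier R" "y \<in> carrier R" "x' \<in> carrier R" "y' \<in> carrier R" for s x y x' y'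
    using that fc unfolding preserves_direction_def plane_group_simps
    by (metis SigmaI plane_group_diff prod.collapse)
  have diff0: "a = b" if "a \<ominus> b = \<zero>" "a \<in> carrier R" "b \<in> carrier R" for a b
    using that by simp
  have split: "f (x, y) = (\<phi> x, \<psi> y)" if xy: "x \<in> carrier R" "y \<in> carrier R" for x y
  proof -
    have "fst (f (x, y)) \<ominus> fst (f (x, \<zero>)) = \<zero>"
      using D[OF dir(1), of x x y \<zero>] xy fc by (simp add: mem_line)
    moreover have "snd (f (x, y)) \<ominus> snd (f (\<zero>, y)) = \<zero>"
      using D[OF dir(2), of x \<zero> y y] xy fc by (simp add: mem_line)
    ultimately show ?thesis
      unfolding \<phi>_def \<psi>_def using xy fc diff0 by (metis prod.collapse zero_closed)
  qed
  have z: "\<phi> \<zero> = \<zero>" "\<psi> \<zero> = \<zero>" using f0 unfolding \<phi>_def \<psi>_def by simp_all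
  have diag: "\<psi> y \<ominus> \<psi> y' = \<phi> x \<ominus> \<phi> x'"
    if "x \<ominus> x' = y \<ominus> y'" "x \<in> carrier R" "y \<in> carrier R" "x' \<in> carrier R" "y' \<in> carrier R"
    for x x' y y'
    using D[OF dir(3), of x x' y y'] that c c' by (auto simp: mem_line split Pi_iff)
  have eq: "\<psi> x = \<phi> x" if "x \<in> carrier R" for x
    using diag[of x \<zero> x \<zero>] that c c' by (auto simp: z Pi_iff a_minus_def)
  show "f (x, y) = (\<phi> x, \<phi> y)" if "x \<in> carrier R" "y \<in> carrier R" for x y
    using split eq that by simp
  show "\<phi> (x \<oplus> y) = \<phi> x \<oplus> \<phi> y" if xy: "x \<in> carrier R" "y \<in> carrier R" for x y
  proof -
    have "x \<oplus> y \<ominus> y = x \<ominus> \<zero>" using xy by (simp add: a_minus_def a_assoc r_neg)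
    hence "\<phi> x \<ominus> \<phi> \<zero> = \<phi> (x \<oplus> y) \<ominus> \<phi> y"
      using diag[of "x \<oplus> y" y x \<zero>] xy eq by simp
    moreover have "\<phi> x \<in> carrier R" "\<phi> y \<in> carrier R" "\<phi> (x \<oplus> y) \<in> carrier R"
      using c xy by auto
    ultimately show ?thesis by (simp add: z a_minus_def) (simp add: a_assoc l_neg)
  qed
qed

section \<open>The field of scalars commuting with additive maps\<close>

lemma (in field) subfield_commuting_scalars:
  assumes E: "\<And>\<phi>. \<phi> \<in> E \<Longrightarrow> \<phi> \<in> carrier R \<rightarrow> carrier R"
    and add: "\<And>\<phi> x y. \<phi> \<in> E \<Longrightarrow> x \<in> carrier R \<Longrightarrow> y \<in> carrier R \<Longrightarrow> \<phi> (x \<oplus> y) = \<phi> x \<oplus> \<phi> y"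
  shows "subfield {\<alpha> \<in> carrier R. \<forall>\<phi>\<in>E. \<forall>x\<in>carrier R. \<phi> (\<alpha> \<otimes> x) = \<alpha> \<otimes> \<phi> x} R"
    (is "subfield ?K R")
proof (rule subfieldI')
  have zero: "\<phi> \<zero> = \<zero>" if "\<phi> \<in> E" for \<phi>
  proof -
    have "\<phi> \<zero> \<oplus> \<phi> \<zero> = \<phi> \<zero>" "\<phi> \<zero> \<in> carrier R"
      using add[OF that, of \<zero> \<zero>] E[OF that] by auto
    thus ?thesis by simp
  qed
  have neg: "\<phi> (\<ominus> x) = \<ominus> \<phi> x" if "\<phi> \<in> E" "x \<in> carrier R" for \<phi> x
  proof -
    have "\<phi> (\<ominus> x) \<oplus> \<phi> x = \<zero>"
      using add[OF that(1), of "\<ominus> x" x] that zero[OF that(1)] by (simp add: l_neg)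
    moreover have "\<phi> (\<ominus> x) \<in> carrier R" "\<phi> x \<in> carrier R" using E that by auto
    ultimately show ?thesis by (simp add: minus_equality)
  qed
  have cl: "\<phi> x \<in> carrier R" if "\<phi> \<in> E" "x \<in> carrier R" for \<phi> x using E that by auto
  show "subring ?K R"
  proof (rule subringI)
    show "\<one> \<in> ?K" using cl by simp
    show "\<ominus> \<alpha> \<in> ?K" if "\<alpha> \<in> ?K" for \<alpha>
      using that cl by (simp add: l_minus neg)
    show "\<alpha> \<otimes> \<beta> \<in> ?K" if "\<alpha> \<in> ?K" "\<beta> \<in> ?K" for \<alpha> \<beta>
      using that cl by (simp add: m_assoc)
    show "\<alpha> \<oplus> \<beta> \<in> ?K" if "\<alpha> \<in> ?K" "\<beta> \<in> ?K" for \<alpha> \<beta>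
      using that cl by (simp add: l_distr add)
  qed simp
  show "inv \<alpha> \<in> ?K" if "\<alpha> \<in> ?K - {\<zero>}" for \<alpha>
  proof -
    have \<alpha>: "\<alpha> \<in> carrier R" "inv \<alpha> \<in> carrier R" "inv \<alpha> \<otimes> \<alpha> = \<one>" "\<alpha> \<otimes> inv \<alpha> = \<one>"
      using that field_Units by auto
    have "\<phi> (inv \<alpha> \<otimes> x) = inv \<alpha> \<otimes> \<phi> x" if \<phi>: "\<phi> \<in> E" and x: "x \<in> carrier R" for \<phi> x
    proof -
      have "\<phi> x = \<phi> (\<alpha> \<otimes> (inv \<alpha> \<otimes> x))" using \<alpha> x by (simp add: m_assoc[symmetric])
      also have "\<dots> = \<alpha> \<otimes> \<phi> (inv \<alpha> \<otimes> x)" using \<open>\<alpha> \<in> ?K - {\<zero>}\<close> \<alpha> \<phi> x by simp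
      finally show ?thesis using \<alpha> cl[OF \<phi>, of "inv \<alpha> \<otimes> x"] x by (simp add: m_assoc[symmetric])
    qed
    thus ?thesis using \<alpha> by simp
  qed
qed

section \<open>The slopes of singleton classes\<close>

lemma (in field) line_subset_line_imp_eq:
  assumes "L \<in> lines R" "\<alpha> \<in> carrier R" "L - {(\<zero>, \<zero>)} \<subseteq> line R (Some \<alpha>)"
  shows "L = line R (Some \<alpha>)"
proof -
  consider "L = line R None" | \<beta> where "\<beta> \<in> carrier R" "L = line R (Some \<beta>)"
    using assms(1) unfolding lines_def slopes_def by blast
  thus ?thesis
  proof cases
    case 1
    hence "(\<zero>, \<one>) \<in> L - {(\<zero>, \<zero>)}" by (simp add: mem_line)
    hence "(\<zero>, \<one>) \<in> line R (Some \<alpha>)" using assms(3) by blast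
    thus ?thesis using assms(2) by (simp add: mem_line)
  next
    case 2
    hence "(\<one>, \<beta>) \<in> L - {(\<zero>, \<zero>)}" by (simp add: mem_line)
    hence "(\<one>, \<beta>) \<in> line R (Some \<alpha>)" using assms(3) by blast
    thus ?thesis using assms(2) 2 by (simp add: mem_line)
  qed
qed

theorem theorem2p2:
  fixes F :: "('a, 'm) ring_scheme" and H :: "('h, 'n) monoid_scheme"
    and \<rho> :: "'a \<times> 'a \<Rightarrow> 'h" and \<pi> :: "('a \<times> 'a) set set set"
  assumes "field F" and "finite (carrier F)"
    and "group H" and "\<rho> \<in> iso (plane_group F) H"
    and "partition_on (lines F) \<pi>"
    and "{None, Some \<zero>\<^bsub>F\<^esub>, Some \<one>\<^bsub>F\<^esub>} \<subseteq> singleton_slopes F \<pi>"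
    and "\<not> subfield {\<alpha>. Some \<alpha> \<in> singleton_slopes F \<pi>} F"
  shows "\<not> schurian H (line_schur_ring F \<rho> \<pi>)"
proof
  assume "schurian H (line_schur_ring F \<rho> \<pi>)"
  interpret field F by fact
  interpret H: group H by fact
  let ?V = "plane_group F" and ?z = "(\<zero>\<^bsub>F\<^esub>, \<zero>\<^bsub>F\<^esub>)"
  note V = plane_group_simps
  interpret hom: group_hom ?V H \<rho>
    using V(1) assms(3,4) by (simp add: group_hom_def group_hom_axioms_def iso_def)
  have bij: "bij_betw \<rho> (carrier ?V) (carrier H)" using assms(4) by (simp add: iso_def)
  have inj: "inj_on \<rho> (carrier ?V)" using bij by (simp add: bij_betw_def)
  obtain \<P> G where schur: "schur_ring H \<P> (line_schur_ring F \<rho> \<pi>)"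
    and G: "subgroup G (BijGroup (carrier H))" "translation_perms H \<subseteq> G"
    and orb: "\<P> = orbits (BijGroup (carrier H)\<lparr>carrier := point_stabilizer H G\<rparr>)
                   (carrier H) (\<lambda>g. g)"
    using \<open>schurian H _\<close> unfolding schurian_def by blast
  let ?S = "point_stabilizer H G"
  have part: "partition_on (carrier H) \<P>" using schur unfolding schur_ring_def by blast
  have P_eq: "\<P> = line_basic_sets F \<rho> \<pi>"
    using schur schur_ring_line_schur_ring[OF assms(1-5)]
    unfolding schur_ring_def by (metis int_span_inject)
  note orbit = block_eq_orbit[OF G(1) assms(3) part orb]
  have S: "h \<in> G" "h \<one>\<^bsub>H\<^esub> = \<one>\<^bsub>H\<^esub>" if "h \<in> ?S" for h
    using that unfolding point_stabilizer_def stabilizer_def by auto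
  have Gmap: "g x \<in> carrier H" if "g \<in> G" "x \<in> carrier H" for g x
  proof -
    have "g \<in> Bij (carrier H)" using subgroup.subset[OF G(1)] that by (auto simp: BijGroup_def)
    thus ?thesis using Bij_imp_funcset that by blast
  qed
  have lineV: "line F s \<subseteq> carrier ?V" if "s \<in> slopes F" for s
    using that by (auto simp: V line_def slopes_def)
  have block: "\<rho> ` punctured_union F P \<in> \<P>" if "P \<in> \<pi>" for P
    using that unfolding P_eq line_basic_sets_def by blast

  \<comment> \<open>The stabilizer acts on the plane by conjugation with \<open>\<rho>\<close>.\<close>
  define conj where "conj h p = inv_into (carrier ?V) \<rho> (h (\<rho> p))" for h p
  have conj: "\<rho> (conj h p) = h (\<rho> p)" "conj h p \<in> carrier ?V"
    if "h \<in> ?S" "p \<in> carrier ?V" for h p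
  proof -
    have "h (\<rho> p) \<in> \<rho> ` carrier ?V"
      using Gmap[OF S(1)[OF that(1)], of "\<rho> p"] that(2) bij by (simp add: bij_betw_def)
    thus "\<rho> (conj h p) = h (\<rho> p)" "conj h p \<in> carrier ?V"
      unfolding conj_def by (simp_all add: f_inv_into_f inv_into_into)
  qed
  have conj_eq: "conj h p = r"
    if "h \<in> ?S" "p \<in> carrier ?V" "r \<in> carrier ?V" "h (\<rho> p) = \<rho> r" for h p r
    using inj_onD[OF inj] conj that by metis
  have conj_zero: "conj h ?z = ?z" if "h \<in> ?S" for h
    using conj_eq[OF that, of ?z ?z] S(2)[OF that] hom.hom_one V by simp

  have inv_line: "conj h p \<in> line F s"
    if h: "h \<in> ?S" and s: "s \<in> singleton_slopes F \<pi>" and p: "p \<in> line F s" for h s p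
  proof (cases "p = ?z")
    case True
    thus ?thesis using conj_zero h p by simp
  next
    case False
    have s': "s \<in> slopes F" "{line F s} \<in> \<pi>" using s by (auto simp: singleton_slopes_def)
    let ?X = "\<rho> ` punctured_union F {line F s}"
    have "\<rho> p \<in> ?X" using p False by (auto simp: punctured_union_def)
    hence "h (\<rho> p) \<in> ?X" using orbit[OF block[OF s'(2)]] h by blast
    then obtain r where r: "r \<in> line F s" "h (\<rho> p) = \<rho> r" by (auto simp: punctured_union_def)
    have "conj h p = r" using conj_eq[OF h _ _ r(2)] lineV[OF s'(1)] p r(1) by blast
    thus ?thesis using r by simp
  qed
  \<comment> \<open>The difference of the images of two points is the image of their difference under another
    element \<open>k\<close> of the stabilizer, and \<open>k\<close> preserves the line through the origin.\<close>
  have dir: "preserves_direction F s (conj h)"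
    if h: "h \<in> ?S" and s: "s \<in> singleton_slopes F \<pi>" for h s
    unfolding preserves_direction_def
  proof (intro ballI impI)
    fix p r assume pr: "p \<in> carrier ?V" "r \<in> carrier ?V"
      and d: "p \<otimes>\<^bsub>?V\<^esub> inv\<^bsub>?V\<^esub> r \<in> line F s"
    obtain k where k: "k \<in> ?S"
      "k (\<rho> p \<otimes>\<^bsub>H\<^esub> inv\<^bsub>H\<^esub> \<rho> r) = h (\<rho> p) \<otimes>\<^bsub>H\<^esub> inv\<^bsub>H\<^esub> h (\<rho> r)"
      using stabilizer_realizes_quotient[OF assms(3) G S(1)[OF h], of "\<rho> r" "\<rho> p"] pr by auto
    have "conj k (p \<otimes>\<^bsub>?V\<^esub> inv\<^bsub>?V\<^esub> r) = conj h p \<otimes>\<^bsub>?V\<^esub> inv\<^bsub>?V\<^esub> conj h r"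
      by (rule conj_eq[OF k(1)]) (use pr k conj[OF h] in auto)
    thus "conj h p \<otimes>\<^bsub>?V\<^esub> inv\<^bsub>?V\<^esub> conj h r \<in> line F s"
      using inv_line[OF k(1) s d] by simp
  qed

  define \<phi> where "\<phi> h x = fst (conj h (x, \<zero>\<^bsub>F\<^esub>))" for h x
  have M3: "None \<in> singleton_slopes F \<pi>" "Some \<zero>\<^bsub>F\<^esub> \<in> singleton_slopes F \<pi>"
    "Some \<one>\<^bsub>F\<^esub> \<in> singleton_slopes F \<pi>" using assms(6) by auto
  have diag: "\<phi> h \<in> carrier F \<rightarrow> carrier F"
    "\<And>x y. x \<in> carrier F \<Longrightarrow> y \<in> carrier F \<Longrightarrow> conj h (x, y) = (\<phi> h x, \<phi> h y)"
    "\<And>x y. x \<in> carrier F \<Longrightarrow> y \<in> carrier F \<Longrightarrow> \<phi> h (x \<oplus>\<^bsub>F\<^esub> y) = \<phi> h x \<oplus>\<^bsub>F\<^esub> \<phi> h y"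
    if h: "h \<in> ?S" for h
  proof -
    have f: "conj h \<in> carrier F \<times> carrier F \<rightarrow> carrier F \<times> carrier F"
      using conj(2)[OF h] unfolding V by blast
    note * = three_directions_imp_diagonal_additive[OF f conj_zero[OF h]
        dir[OF h M3(1)] dir[OF h M3(2)] dir[OF h M3(3)], folded \<phi>_def]
    show "\<phi> h \<in> carrier F \<rightarrow> carrier F" using *(1) by (simp add: Pi_iff \<phi>_def)
    show "\<And>x y. x \<in> carrier F \<Longrightarrow> y \<in> carrier F \<Longrightarrow> conj h (x, y) = (\<phi> h x, \<phi> h y)"
      "\<And>x y. x \<in> carrier F \<Longrightarrow> y \<in> carrier F \<Longrightarrow> \<phi> h (x \<oplus>\<^bsub>F\<^esub> y) = \<phi> h x \<oplus>\<^bsub>F\<^esub> \<phi> h y"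
      using *(2,3) by blast+
  qed

  let ?K = "{\<alpha> \<in> carrier F. \<forall>\<theta>\<in>\<phi> ` ?S. \<forall>x\<in>carrier F. \<theta> (\<alpha> \<otimes>\<^bsub>F\<^esub> x) = \<alpha> \<otimes>\<^bsub>F\<^esub> \<theta> x}"
  have "subfield ?K F"
    by (rule subfield_commuting_scalars) (use diag in auto)
  moreover have "{\<alpha>. Some \<alpha> \<in> singleton_slopes F \<pi>} = ?K"
  proof (intro equalityI subsetI)
    fix \<alpha> assume "\<alpha> \<in> {\<alpha>. Some \<alpha> \<in> singleton_slopes F \<pi>}"
    hence s: "Some \<alpha> \<in> singleton_slopes F \<pi>" by simp
    hence \<alpha>: "\<alpha> \<in> carrier F" by (auto simp: singleton_slopes_def slopes_def)
    have "\<phi> h (\<alpha> \<otimes>\<^bsub>F\<^esub> x) = \<alpha> \<otimes>\<^bsub>F\<^esub> \<phi> h x" if h: "h \<in> ?S" and x: "x \<in> carrier F" for h x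
      using inv_line[OF h s, of "(x, \<alpha> \<otimes>\<^bsub>F\<^esub> x)"] diag(2)[OF h, of x "\<alpha> \<otimes>\<^bsub>F\<^esub> x"] \<alpha> x
      by (simp add: mem_line)
    thus "\<alpha> \<in> ?K" using \<alpha> by blast
  next
    fix \<alpha> assume \<alpha>: "\<alpha> \<in> ?K"
    hence \<alpha>F: "\<alpha> \<in> carrier F" by simp
    hence s: "Some \<alpha> \<in> slopes F" by (simp add: slopes_def)
    let ?L = "line F (Some \<alpha>)" and ?p = "(\<one>\<^bsub>F\<^esub>, \<alpha>)"
    have "?L \<in> lines F" using s by (simp add: lines_def)
    then obtain P where P: "P \<in> \<pi>" "?L \<in> P" using assms(5) unfolding partition_on_def by blast
    have p: "?p \<in> punctured_union F P"
    proof -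
      have "?p \<in> ?L - {?z}" using \<alpha>F by (simp add: mem_line)
      thus ?thesis unfolding punctured_union_def using P(2) by blast
    qed
    have PL: "L \<in> lines F" if "L \<in> P" for L
      using that P(1) assms(5) unfolding partition_on_def by blast
    \<comment> \<open>The basic set of \<open>P\<close> is the orbit of the point \<open>(1, \<alpha>)\<close> of the line.\<close>
    have "punctured_union F P \<subseteq> ?L"
    proof
      fix r assume r: "r \<in> punctured_union F P"
      have rV: "r \<in> carrier ?V"
    proof -
      obtain L where "L \<in> lines F" "r \<in> L" using r PL by (auto simp: punctured_union_def)
      thus ?thesis using lineV by (auto simp: lines_def)
    qed
      have "\<rho> r \<in> {h (\<rho> ?p) | h. h \<in> ?S}"
        using orbit[OF block[OF P(1)], of "\<rho> ?p"] p r by blast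
      then obtain h where h: "h \<in> ?S" "h (\<rho> ?p) = \<rho> r" by auto
      have "conj h ?p = r" using conj_eq[OF h(1) _ rV h(2)] \<alpha>F by (simp add: V)
      hence "r = (\<phi> h \<one>\<^bsub>F\<^esub>, \<phi> h (\<alpha> \<otimes>\<^bsub>F\<^esub> \<one>\<^bsub>F\<^esub>))" using diag(2)[OF h(1)] \<alpha>F by simp
      also have "\<dots> = (\<phi> h \<one>\<^bsub>F\<^esub>, \<alpha> \<otimes>\<^bsub>F\<^esub> \<phi> h \<one>\<^bsub>F\<^esub>)" using \<alpha> h(1) by blast
      finally show "r \<in> ?L" using diag(1)[OF h(1)] \<alpha>F by (auto simp: mem_line)
    qed
    hence "L = ?L" if "L \<in> P" for L
      using line_subset_line_imp_eq[OF PL[OF that] \<alpha>F] that by (auto simp: punctured_union_def)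
    hence "P = {?L}" using P(2) by blast
    thus "\<alpha> \<in> {\<alpha>. Some \<alpha> \<in> singleton_slopes F \<pi>}"
      using P(1) s by (simp add: singleton_slopes_def)
  qed
  ultimately show False using assms(7) by simp
qed

end
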